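(* Let $X$ be a Tychonoff space such that the space $C_k(X)$ is bornological. Then $C_k(X)$ is barrelled if and only if it is a Mackey group.
   Context: For a Tychonoff space $X$, $C_k(X)$ is the locally convex space of all continuous real-valued functions on $X$ endowed with the compact-open topology. "Bornological" and "barrelled" refer to the locally convex space structure, and "Mackey group" refers to the underlying additive abelian topological group. Let $\mathbb{S}$ be the unit circle group and $\mathbb{S}_+=\{z\in\mathbb{S}:\ \mathrm{Re}(z)\ge 0\}$. For an abelian topological group $G$, $\widehat{G}$ is the group of all continuous characters, i.e. continuous homomorphisms $G\to\mathbb{S}$. $G$ is maximally almost periodic (MAP) if $\widehat{G}$ separates the points of $G$. A subset $A\subseteq G$ is quasi-convex if for every $g\in G\setminus A$ there is $\chi\in\widehat{G}$ with $\chi(g)\notin\mathbb{S}_+$ and $\chi(A)\subseteq\mathbb{S}_+$. $G$ is locally quasi-convex if it has a neighborhood base at $0$ consisting of quasi-convex sets; locally quasi-convex groups are understood to be MAP. Two group topologies $\tau,\nu$ on an abelian group $G$ are compatible if $\widehat{(G,\tau)}=\widehat{(G,\nu)}$. A locally quasi-convex abelian group $(G,\tau)$ is a Mackey group if every locally quasi-convex group topology $\nu$ on $G$ compatible with $\tau$ satisfies $\nu\le\tau$. *)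

theory Defs
  imports "HOL-Analysis.Analysis" "HOL-Library.Function_Algebras"
begin

text \<open>Groups and vector spaces are carried by the underlying set of an abstract topology: a
  topological abelian group is a topology \<open>T\<close> whose \<open>topspace\<close> is a subgroup of the ambient
  \<open>ab_group_add\<close> type, and a topological vector space is one whose \<open>topspace\<close> is a subspace of the
  ambient \<open>real_vector\<close> type.\<close>

definition coarser :: "'a topology \<Rightarrow> 'a topology \<Rightarrow> bool" where
  "coarser N T \<longleftrightarrow> (\<forall>U. openin N U \<longrightarrow> openin T U)"

definition nbhd_of_zero :: "'a::zero topology \<Rightarrow> 'a set \<Rightarrow> bool" where
  "nbhd_of_zero T A \<longleftrightarrow> A \<subseteq> topspace T \<and> (\<exists>U. openin T U \<and> 0 \<in> U \<and> U \<subseteq> A)"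


section \<open>Abelian topological groups\<close>

definition topological_abelian_group :: "'g::ab_group_add topology \<Rightarrow> bool" where
  "topological_abelian_group T \<longleftrightarrow>
     0 \<in> topspace T \<and>
     continuous_map (prod_topology T T) T (\<lambda>(x, y). x + y) \<and>
     continuous_map T T uminus"

definition circle :: "complex set" where
  "circle = sphere 0 1"

definition circle_plus :: "complex set" where
  "circle_plus = {z \<in> circle. Re z \<ge> 0}"

text \<open>Extensionality makes equality of dual groups mean equality of the characters as functions on
  the group.\<close>

definition dual_group :: "'g::ab_group_add topology \<Rightarrow> ('g \<Rightarrow> complex) set" where
  "dual_group T = {\<phi> \<in> extensional (topspace T).
     continuous_map T (top_of_set circle) \<phi> \<and>
     (\<forall>x \<in> topspace T. \<forall>y \<in> topspace T. \<phi> (x + y) = \<phi> x * \<phi> y)}"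

definition MAP_group :: "'g::ab_group_add topology \<Rightarrow> bool" where
  "MAP_group T \<longleftrightarrow> topological_abelian_group T \<and>
     (\<forall>x \<in> topspace T. \<forall>y \<in> topspace T. x \<noteq> y \<longrightarrow> (\<exists>\<phi> \<in> dual_group T. \<phi> x \<noteq> \<phi> y))"

definition quasi_convex :: "'g::ab_group_add topology \<Rightarrow> 'g set \<Rightarrow> bool" where
  "quasi_convex T A \<longleftrightarrow> A \<subseteq> topspace T \<and>
     (\<forall>g \<in> topspace T - A. \<exists>\<phi> \<in> dual_group T. \<phi> g \<notin> circle_plus \<and> \<phi> ` A \<subseteq> circle_plus)"

definition locally_quasi_convex :: "'g::ab_group_add topology \<Rightarrow> bool" where
  "locally_quasi_convex T \<longleftrightarrow> MAP_group T \<and> neighbourhood_base_at 0 (quasi_convex T) T"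

definition compatible_topologies ::
    "'g::ab_group_add topology \<Rightarrow> 'g topology \<Rightarrow> bool" where
  "compatible_topologies T N \<longleftrightarrow> topspace T = topspace N \<and> dual_group T = dual_group N"

definition Mackey_group :: "'g::ab_group_add topology \<Rightarrow> bool" where
  "Mackey_group T \<longleftrightarrow> locally_quasi_convex T \<and>
     (\<forall>N. locally_quasi_convex N \<and> compatible_topologies T N \<longrightarrow> coarser N T)"


section \<open>Locally convex spaces\<close>

definition locally_convex_space :: "'v::real_vector topology \<Rightarrow> bool" where
  "locally_convex_space T \<longleftrightarrow>
     subspace (topspace T) \<and>
     continuous_map (prod_topology T T) T (\<lambda>(x, y). x + y) \<and>
     continuous_map (prod_topology euclideanreal T) T (\<lambda>(c, x). c *\<^sub>R x) \<and>
     neighbourhood_base_at 0 convex T"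

definition balanced :: "'v::real_vector set \<Rightarrow> bool" where
  "balanced A \<longleftrightarrow> (\<forall>c. \<forall>x \<in> A. \<bar>c\<bar> \<le> 1 \<longrightarrow> c *\<^sub>R x \<in> A)"

definition absolutely_convex :: "'v::real_vector set \<Rightarrow> bool" where
  "absolutely_convex A \<longleftrightarrow> convex A \<and> balanced A"

definition absorbs :: "'v::real_vector set \<Rightarrow> 'v set \<Rightarrow> bool" where
  "absorbs A B \<longleftrightarrow> (\<exists>r>0. \<forall>c. \<bar>c\<bar> \<ge> r \<longrightarrow> B \<subseteq> (\<lambda>x. c *\<^sub>R x) ` A)"

definition tvs_bounded :: "'v::real_vector topology \<Rightarrow> 'v set \<Rightarrow> bool" where
  "tvs_bounded T B \<longleftrightarrow> B \<subseteq> topspace T \<and> (\<forall>U. nbhd_of_zero T U \<longrightarrow> absorbs U B)"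

definition bornivorous :: "'v::real_vector topology \<Rightarrow> 'v set \<Rightarrow> bool" where
  "bornivorous T A \<longleftrightarrow> A \<subseteq> topspace T \<and> (\<forall>B. tvs_bounded T B \<longrightarrow> absorbs A B)"

definition barrel :: "'v::real_vector topology \<Rightarrow> 'v set \<Rightarrow> bool" where
  "barrel T A \<longleftrightarrow> closedin T A \<and> absolutely_convex A \<and> (\<forall>x \<in> topspace T. absorbs A {x})"

definition bornological :: "'v::real_vector topology \<Rightarrow> bool" where
  "bornological T \<longleftrightarrow> locally_convex_space T \<and>
     (\<forall>A. absolutely_convex A \<and> bornivorous T A \<longrightarrow> nbhd_of_zero T A)"

definition barrelled :: "'v::real_vector topology \<Rightarrow> bool" where
  "barrelled T \<longleftrightarrow> locally_convex_space T \<and> (\<forall>A. barrel T A \<longrightarrow> nbhd_of_zero T A)"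


section \<open>Spaces of continuous functions with the compact-open topology\<close>

definition Tychonoff_space :: "'a topology \<Rightarrow> bool" where
  "Tychonoff_space X \<longleftrightarrow> completely_regular_space X \<and> Hausdorff_space X"

instantiation "fun" :: (type, real_vector) real_vector
begin

definition scaleR_fun :: "real \<Rightarrow> ('a \<Rightarrow> 'b) \<Rightarrow> 'a \<Rightarrow> 'b" where
  "scaleR_fun c f = (\<lambda>x. c *\<^sub>R f x)"

instance
  by standard (simp_all add: scaleR_fun_def fun_eq_iff scaleR_add_right scaleR_add_left)

end

text \<open>Continuous functions on \<open>topspace X\<close> are extended by \<open>0\<close> to the whole type, so that every such
  function has one representative and the representatives form a subspace of \<open>'a \<Rightarrow> real\<close>.\<close>

definition continuous_functions :: "'a topology \<Rightarrow> ('a \<Rightarrow> real) set" where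
  "continuous_functions X =
     {f. continuous_map X euclideanreal f \<and> (\<forall>x. x \<notin> topspace X \<longrightarrow> f x = 0)}"

definition C_k :: "'a topology \<Rightarrow> ('a \<Rightarrow> real) topology" where
  "C_k X = topology_generated_by
     {{f \<in> continuous_functions X. f ` K \<subseteq> U} | K U. compactin X K \<and> open U}"

lemma topspace_C_k [simp]: "topspace (C_k X) = continuous_functions X"
proof -
  have "continuous_functions X \<in>
      {{f \<in> continuous_functions X. f ` K \<subseteq> U} | K U. compactin X K \<and> open U}"
    by (rule CollectI, rule exI[of _ "{}"], rule exI[of _ UNIV]) auto
  then show ?thesis
    unfolding C_k_def topology_generated_by_topspace by blast
qed

lemma subspace_continuous_functions: "subspace (continuous_functions X)"
  by (auto simp: subspace_def continuous_functions_def scaleR_fun_def plus_fun_def zero_fun_def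
      intro: continuous_map_add continuous_map_real_mult)

end

theory Submission
  imports Defs
begin

text \<open>Under the hypotheses both sides of the equivalence hold, and the proof establishes each of them.

  \<^bold>\<open>A bornological \<open>C_k X\<close> is barrelled.\<close>  A barrel \<open>B\<close> absorbs every order interval
  \<open>{f. \<bar>f\<bar> \<le> h}\<close>, because such an interval is a Banach disc
  (\<open>barrel_absorbs_order_interval\<close>, a Baire argument).  Attach to \<open>B\<close> its support: the set
  of points no neighbourhood of which carries only functions of \<open>B\<close>.  Order intervals with rapidly
  growing \<open>h\<close> show that every continuous function is bounded on the support
  (\<open>functionally_bounded_barrel_support\<close>).  A partition of unity and the closedness of \<open>B\<close>
  show that \<open>B\<close> contains all functions vanishing near the support, and together with the interval
  \<open>{f. \<bar>f\<bar> \<le> 1}\<close> also all functions that are small on the support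
  (\<open>barrel_contains_tube_on_support\<close>).  It remains to see that the support is compact, and only here
  the bornological hypothesis enters
  (\<open>bornological_closed_functionally_bounded_compact\<close>): a pointwise limit \<open>L\<close> of
  evaluations at points of a functionally bounded set agrees on any sequence of functions with the
  evaluation at some point, so \<open>L\<close> is bounded on bounded sets, hence continuous, hence controlled
  by a compact set, hence an evaluation.  Thus the evaluations at the points of the support
  form a compact set of functionals.

  \<^bold>\<open>A barrelled locally quasi-convex space \<open>T\<close> is a Mackey group.\<close>  Let \<open>N\<close> be a compatible
  locally quasi-convex topology and \<open>U\<close> a quasi-convex neighbourhood of zero for \<open>N\<close>.  Every
  character in the polar of \<open>U\<close> is continuous for \<open>T\<close>, so on each line it has a frequency, and
  the frequency is linear in the vector.  The polar is compact for pointwise convergence, and a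
  compact set of characters of the real line has bounded frequencies: the characters of a lacunary
  sequence of frequencies can be kept away from \<open>1\<close> simultaneously at arbitrarily small times,
  which no continuous cluster character allows (\<open>circle_polar_frequency_bounded\<close>).  Hence the
  vectors on which all frequencies are at most \<open>pi / 2\<close> form a barrel contained in \<open>U\<close>.

  The space \<open>C_k X\<close> itself is locally quasi-convex because exponentials of evaluations are
  characters.\<close>


section \<open>Neighbourhoods and barrels in the compact-open topology\<close>

lemma continuous_functionsD:
  assumes "f \<in> continuous_functions X"
  shows "continuous_map X euclideanreal f" "x \<notin> topspace X \<Longrightarrow> f x = 0"
  using assms by (auto simp: continuous_functions_def)

text \<open>The representative in \<open>continuous_functions X\<close> of a function given by a formula, which
  need not vanish outside the space.\<close>
definition zero_extension :: "'a topology \<Rightarrow> ('a \<Rightarrow> real) \<Rightarrow> 'a \<Rightarrow> real" where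
  "zero_extension X f = (\<lambda>x. if x \<in> topspace X then f x else 0)"

lemma zero_extension_apply [simp]: "x \<in> topspace X \<Longrightarrow> zero_extension X f x = f x"
  by (simp add: zero_extension_def)

lemma zero_extension_in [intro]:
  assumes "continuous_map X euclideanreal f"
  shows "zero_extension X f \<in> continuous_functions X"
proof -
  have "continuous_map X euclideanreal (zero_extension X f)"
    using continuous_map_eq[OF assms, of "zero_extension X f"] by simp
  then show ?thesis
    by (simp add: continuous_functions_def zero_extension_def)
qed

lemma continuous_functions_add:
  "f \<in> continuous_functions X \<Longrightarrow> g \<in> continuous_functions X \<Longrightarrow> f + g \<in> continuous_functions X"
  by (rule subspace_add[OF subspace_continuous_functions])

lemma continuous_functions_diff:
  "f \<in> continuous_functions X \<Longrightarrow> g \<in> continuous_functions X \<Longrightarrow> f - g \<in> continuous_functions X"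
  by (rule subspace_diff[OF subspace_continuous_functions])

lemma continuous_functions_scaleR:
  "f \<in> continuous_functions X \<Longrightarrow> c *\<^sub>R f \<in> continuous_functions X"
  by (rule subspace_scale[OF subspace_continuous_functions])

lemma scaleR_fun_apply [simp]: "(c *\<^sub>R f) x = c * (f x :: real)"
  by (simp add: scaleR_fun_def)

definition tube :: "'a topology \<Rightarrow> 'a set \<Rightarrow> real \<Rightarrow> ('a \<Rightarrow> real) \<Rightarrow> ('a \<Rightarrow> real) set" where
  "tube X K e f = {g \<in> continuous_functions X. \<forall>x\<in>K. \<bar>g x - f x\<bar> \<le> e}"

text \<open>Compactness of the image of \<open>K\<close> turns the open condition on the values of \<open>f\<close>
  in a subbasic set into a uniform one, so the tubes around \<open>f\<close> are small enough to form a
  neighbourhood base.\<close>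
lemma C_k_open_contains_tube:
  assumes "openin (C_k X) W" "f \<in> W"
  obtains K e where "compactin X K" "e > 0" "tube X K e f \<subseteq> W"
proof -
  have "generate_topology_on
      {{f \<in> continuous_functions X. f ` K \<subseteq> U} | K U. compactin X K \<and> open U} W"
    using assms(1) unfolding C_k_def by (rule openin_topology_generated_by)
  then have "\<exists>K e. compactin X K \<and> e > 0 \<and> tube X K e f \<subseteq> W"
    using assms(2)
  proof (induction)
    case Empty
    then show ?case by blast
  next
    case (Int a b)
    have "\<exists>K e. compactin X K \<and> e > 0 \<and> tube X K e f \<subseteq> a"
         "\<exists>K e. compactin X K \<and> e > 0 \<and> tube X K e f \<subseteq> b"
      using Int by simp_all
    then obtain K e K' e' where K:
      "compactin X K" "e > 0" "tube X K e f \<subseteq> a" "compactin X K'" "e' > 0" "tube X K' e' f \<subseteq> b"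
      by metis
    have "tube X (K \<union> K') (min e e') f \<subseteq> tube X K e f \<inter> tube X K' e' f"
      by (auto simp: tube_def)
    then have "tube X (K \<union> K') (min e e') f \<subseteq> a \<inter> b"
      using K(3,6) by blast
    moreover have "compactin X (K \<union> K')" "min e e' > 0" using K by (simp_all add: compactin_Un)
    ultimately show ?case by metis
  next
    case (UN \<K>)
    then obtain k where "k \<in> \<K>" "f \<in> k" by blast
    then obtain K e where K: "compactin X K" "e > 0" "tube X K e f \<subseteq> k"
      using UN.IH by metis
    have "tube X K e f \<subseteq> \<Union>\<K>" using K(3) \<open>k \<in> \<K>\<close> by blast
    with K(1,2) show ?case by metis
  next
    case (Basis s)
    then obtain K U where s: "s = {f \<in> continuous_functions X. f ` K \<subseteq> U}"
      and K: "compactin X K" and U: "open U" by blast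
    have f: "f \<in> continuous_functions X" "f ` K \<subseteq> U" using Basis s by auto
    have "compactin euclideanreal (f ` K)"
      using image_compactin[OF K continuous_functionsD(1)[OF f(1)]] .
    then have "compact (f ` K)" by simp
    then obtain e where e: "e > 0" "(\<Union>x\<in>f ` K. ball x e) \<subseteq> U"
      using compact_subset_open_imp_ball_epsilon_subset[OF _ U f(2)] by metis
    have "g x \<in> U" if "g \<in> tube X K (e/2) f" "x \<in> K" for g x
    proof -
      have "\<bar>g x - f x\<bar> \<le> e / 2" using that by (auto simp: tube_def)
      then have "dist (f x) (g x) < e"
        using e(1) by (simp add: dist_real_def abs_minus_commute)
      then show "g x \<in> U" using e(2) \<open>x \<in> K\<close> by (auto simp: subset_iff)
    qed
    then have "tube X K (e/2) f \<subseteq> s" by (auto simp: s tube_def)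
    then show ?case using K e(1) half_gt_zero by metis
  qed
  then show thesis using that by metis
qed

lemma openin_C_k_tube:
  assumes "compactin X K"
  shows "openin (C_k X) {g \<in> continuous_functions X. \<forall>x\<in>K. \<bar>g x\<bar> < e}"
proof -
  have *: "{g \<in> continuous_functions X. \<forall>x\<in>K. \<bar>g x\<bar> < e} =
        {g \<in> continuous_functions X. g ` K \<subseteq> {-e<..<e}}" by (auto simp: abs_less_iff)
  have "open {-e<..<e}" by simp
  then show ?thesis
    unfolding C_k_def * using assms by (intro topology_generated_by_Basis CollectI exI conjI) auto
qed

lemma nbhd_of_zero_C_k:
  "nbhd_of_zero (C_k X) A \<longleftrightarrow>
     A \<subseteq> continuous_functions X \<and> (\<exists>K e. compactin X K \<and> e > 0 \<and> tube X K e 0 \<subseteq> A)"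
  (is "_ \<longleftrightarrow> _ \<and> ?R")
proof -
  have "\<exists>U. openin (C_k X) U \<and> 0 \<in> U \<and> U \<subseteq> A"
    if "compactin X K" "e > 0" "tube X K e 0 \<subseteq> A" for K e
  proof (intro exI conjI)
    show "openin (C_k X) {g \<in> continuous_functions X. \<forall>x\<in>K. \<bar>g x\<bar> < e}"
      using that by (simp add: openin_C_k_tube)
    show "0 \<in> {g \<in> continuous_functions X. \<forall>x\<in>K. \<bar>g x\<bar> < e}"
      using that subspace_0[OF subspace_continuous_functions] by auto
    have "{g \<in> continuous_functions X. \<forall>x\<in>K. \<bar>g x\<bar> < e} \<subseteq> tube X K e 0"
      by (auto simp: tube_def less_imp_le)
    then show "{g \<in> continuous_functions X. \<forall>x\<in>K. \<bar>g x\<bar> < e} \<subseteq> A"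
      using that(3) by (rule subset_trans)
  qed
  moreover have ?R if U: "openin (C_k X) U" "0 \<in> U" "U \<subseteq> A" for U
    proof -
    obtain K e where "compactin X K" "e > 0" "tube X K e 0 \<subseteq> U"
      using C_k_open_contains_tube[OF U(1,2)] .
    with U(3) show ?thesis by (intro exI[of _ K] exI[of _ e]) simp
  qed
  ultimately have "(\<exists>U. openin (C_k X) U \<and> 0 \<in> U \<and> U \<subseteq> A) \<longleftrightarrow> ?R" by metis
  then show ?thesis
    unfolding nbhd_of_zero_def topspace_C_k by simp
qed

lemma barrel_C_kD:
  assumes "barrel (C_k X) B"
  shows "convex B" "balanced B" "B \<subseteq> continuous_functions X"
  using assms closedin_subset[of "C_k X" B] by (auto simp: barrel_def absolutely_convex_def)

text \<open>The form in which the closedness of a barrel is used throughout.\<close>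
lemma barrel_C_k_separate:
  assumes "barrel (C_k X) B" "f \<in> continuous_functions X" "f \<notin> B"
  obtains K e where "compactin X K" "e > 0" "tube X K e f \<inter> B = {}"
proof -
  have "openin (C_k X) (continuous_functions X - B)"
    using assms(1) by (simp add: barrel_def closedin_def)
  moreover have "f \<in> continuous_functions X - B" using assms by simp
  ultimately obtain K e where "compactin X K" "e > 0" "tube X K e f \<subseteq> continuous_functions X - B"
    using C_k_open_contains_tube by metis
  then show thesis using that by blast
qed

lemma balanced_scaleR_mono:
  assumes "balanced B" "\<bar>s\<bar> \<le> \<bar>t\<bar>" "t *\<^sub>R f \<in> B"
  shows "s *\<^sub>R f \<in> B"
proof (cases "t = 0")
  case True then show ?thesis using assms by simp
next
  case False
  have "(s / t) *\<^sub>R (t *\<^sub>R f) \<in> B"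
    using assms False unfolding balanced_def
    by (metis abs_divide divide_le_eq_1 abs_ge_zero zero_less_abs_iff)
  then show ?thesis using False by simp
qed

lemma absorbs_point:
  assumes "absorbs B {f}"
  shows "\<exists>n::nat. inverse (real (Suc n)) *\<^sub>R f \<in> B"
proof -
  obtain r where r: "r > 0" "\<And>c. \<bar>c\<bar> \<ge> r \<Longrightarrow> {f} \<subseteq> (\<lambda>x. c *\<^sub>R x) ` B"
    using assms unfolding absorbs_def by blast
  obtain n where n: "real n \<ge> r" using real_arch_simple by blast
  then have "{f} \<subseteq> (\<lambda>x. real (Suc n) *\<^sub>R x) ` B" by (intro r) auto
  then obtain b where "b \<in> B" "f = real (Suc n) *\<^sub>R b" by blast
  then have "inverse (real (Suc n)) *\<^sub>R f = b" by (simp del: of_nat_Suc)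
  with \<open>b \<in> B\<close> show ?thesis by metis
qed

section \<open>Barrels absorb order intervals\<close>

lemma compactin_bounded:
  assumes "compactin X K" "h \<in> continuous_functions X"
  obtains c :: real where "c > 0" "\<And>x. x \<in> K \<Longrightarrow> \<bar>h x\<bar> \<le> c"
proof -
  have "compactin euclideanreal (h ` K)"
    using image_compactin[OF assms(1) continuous_functionsD(1)[OF assms(2)]] .
  then have "bounded (h ` K)" by (simp add: compact_imp_bounded)
  then obtain c where "c > 0" "\<forall>y\<in>h ` K. norm y \<le> c" using bounded_pos by blast
  then show thesis using that by auto
qed

text \<open>One step of the Baire argument.  Here \<open>B\<close> does not absorb the order interval of \<open>h\<close>.
  Some small multiple \<open>d\<close> of a function of the interval lies outside \<open>B\<close> scaled by \<open>Suc n\<close>;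
  since \<open>d\<close> is half the difference of \<open>g + d\<close> and \<open>g - d\<close>, one of these two lies outside as
  well, and by closedness of \<open>B\<close> so does a whole order neighbourhood of it.\<close>
lemma barrel_escape_step:
  assumes B: "barrel (C_k X) B" and h: "h \<in> continuous_functions X"
    and unabsorbed: "\<And>n. \<exists>f\<in>continuous_functions X.
      (\<forall>x\<in>topspace X. \<bar>f x\<bar> \<le> h x) \<and> f /\<^sub>R real (Suc n) \<notin> B"
    and g: "g \<in> continuous_functions X" and r: "r > 0"
  obtains g' r' where "g' \<in> continuous_functions X" "0 < r'" "r' \<le> r / 2"
    "\<And>x. x \<in> topspace X \<Longrightarrow> \<bar>g' x - g x\<bar> \<le> r / 2 * h x"
    "\<And>u. u \<in> continuous_functions X \<Longrightarrow> (\<And>x. x \<in> topspace X \<Longrightarrow> \<bar>u x - g' x\<bar> \<le> r' * h x) \<Longrightarrow>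
       u /\<^sub>R real (Suc n) \<notin> B"
proof -
  note B' = barrel_C_kD[OF B]
  obtain m :: nat where m: "2 * real (Suc n) / r \<le> real m" using real_arch_simple by blast
  obtain f where f: "f \<in> continuous_functions X" "\<And>x. x \<in> topspace X \<Longrightarrow> \<bar>f x\<bar> \<le> h x"
    "f /\<^sub>R real (Suc m) \<notin> B" using unabsorbed[of m] by blast
  have "inverse (real (Suc m)) \<le> (r / 2) / real (Suc n)"
    using m r by (simp add: field_simps)
  then have *: "((r / 2) / real (Suc n)) *\<^sub>R f \<notin> B"
    using f(3) balanced_scaleR_mono[OF B'(2), of "inverse (real (Suc m))" "(r / 2) / real (Suc n)" f] r
    by (auto simp del: of_nat_Suc)
  have "\<exists>g'. (g' = g + (r/2) *\<^sub>R f \<or> g' = g - (r/2) *\<^sub>R f) \<and> g' /\<^sub>R real (Suc n) \<notin> B"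
  proof (rule ccontr)
    assume "\<not> ?thesis"
    then have 1: "(g + (r/2) *\<^sub>R f) /\<^sub>R real (Suc n) \<in> B" "(g - (r/2) *\<^sub>R f) /\<^sub>R real (Suc n) \<in> B"
      by blast+
    have "- ((g - (r/2) *\<^sub>R f) /\<^sub>R real (Suc n)) \<in> B"
      using balanced_scaleR_mono[OF B'(2), of "-1" 1] 1(2) by simp
    then have mid: "(1/2) *\<^sub>R ((g + (r/2) *\<^sub>R f) /\<^sub>R real (Suc n))
              + (1/2) *\<^sub>R (- ((g - (r/2) *\<^sub>R f) /\<^sub>R real (Suc n))) \<in> B"
      using B'(1) 1(1) by (intro convexD) auto
    have "(1/2) *\<^sub>R ((g + (r/2) *\<^sub>R f) /\<^sub>R real (Suc n))
              + (1/2) *\<^sub>R (- ((g - (r/2) *\<^sub>R f) /\<^sub>R real (Suc n))) = ((r / 2) / real (Suc n)) *\<^sub>R f"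
      by (simp add: fun_eq_iff field_simps)
    then show False using mid * by metis
  qed
  then obtain g' where g': "g' = g + (r/2) *\<^sub>R f \<or> g' = g - (r/2) *\<^sub>R f" "g' /\<^sub>R real (Suc n) \<notin> B"
    by blast
  have g'C: "g' \<in> continuous_functions X"
    using g'(1) f(1) g continuous_functions_add continuous_functions_diff continuous_functions_scaleR
    by metis
  obtain K e where K: "compactin X K" "e > 0" "tube X K e (g' /\<^sub>R real (Suc n)) \<inter> B = {}"
    using barrel_C_k_separate[OF B continuous_functions_scaleR[OF g'C] g'(2)] .
  obtain c where c: "c > 0" "\<And>x. x \<in> K \<Longrightarrow> \<bar>h x\<bar> \<le> c" using compactin_bounded[OF K(1) h] by metis
  \<comment> \<open>With this radius the order neighbourhood of \<open>g'\<close> lies in the tube over \<open>K\<close> that avoids \<open>B\<close>.\<close>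
  define r' where "r' = min (r / 2) (e / c)"
  show thesis
  proof (rule that[of g' r'])
    show "g' \<in> continuous_functions X" "0 < r'" "r' \<le> r / 2"
      using g'C r K(2) c(1) min.cobounded1[of "r / 2" "e / c"] by (auto simp: r'_def)
    show "\<bar>g' x - g x\<bar> \<le> r / 2 * h x" if "x \<in> topspace X" for x
      using g'(1) f(2)[OF that] r by (auto simp: abs_mult)
    fix u assume u: "u \<in> continuous_functions X" "\<And>x. x \<in> topspace X \<Longrightarrow> \<bar>u x - g' x\<bar> \<le> r' * h x"
    have "\<bar>(u /\<^sub>R real (Suc n)) x - (g' /\<^sub>R real (Suc n)) x\<bar> \<le> e" if "x \<in> K" for x
    proof -
      have "x \<in> topspace X" using that compactin_subset_topspace[OF K(1)] by blast
      have "\<bar>(u /\<^sub>R real (Suc n)) x - (g' /\<^sub>R real (Suc n)) x\<bar> = \<bar>u x - g' x\<bar> / real (Suc n)"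
        by (simp add: field_simps flip: diff_divide_distrib)
      also have "\<dots> \<le> \<bar>u x - g' x\<bar> / 1" by (intro divide_left_mono) auto
      also have "\<dots> \<le> r' * h x" using u(2)[OF \<open>x \<in> topspace X\<close>] by simp
      also have "\<dots> \<le> (e / c) * c" using c(2)[OF that] c(1) K(2) \<open>0 < r'\<close> f(2)[OF \<open>x \<in> topspace X\<close>]
        by (intro mult_mono') (auto simp: r'_def)
      finally show ?thesis using c(1) by simp
    qed
    then have "u /\<^sub>R real (Suc n) \<in> tube X K e (g' /\<^sub>R real (Suc n))"
      using continuous_functions_scaleR[OF u(1)] by (simp add: tube_def)
    then show "u /\<^sub>R real (Suc n) \<notin> B" using K(3) by blast
  qed
qed

text \<open>Completeness of the Banach space spanned by an order interval: after division by \<open>h\<close> the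
  Cauchy condition is uniform, so the limit is again continuous.\<close>
lemma continuous_functions_weighted_limit:
  fixes g :: "nat \<Rightarrow> 'a \<Rightarrow> real" and r :: "nat \<Rightarrow> real"
  assumes h: "h \<in> continuous_functions X" "\<And>x. x \<in> topspace X \<Longrightarrow> 1 \<le> h x"
    and g: "\<And>n. g n \<in> continuous_functions X" and r: "r \<longlonglongrightarrow> 0"
    and cauchy: "\<And>m n x. m \<le> n \<Longrightarrow> x \<in> topspace X \<Longrightarrow> \<bar>g n x - g m x\<bar> \<le> r m * h x"
  obtains u where "u \<in> continuous_functions X"
    "\<And>m x. x \<in> topspace X \<Longrightarrow> \<bar>u x - g m x\<bar> \<le> r m * h x"
proof -
  have "\<exists>l. (\<lambda>n. g n x) \<longlonglongrightarrow> l" if x: "x \<in> topspace X" for x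
  proof -
    have "(\<lambda>n. r n * h x) \<longlonglongrightarrow> 0 * h x" by (intro tendsto_intros r)
    then have r': "(\<lambda>n. r n * h x) \<longlonglongrightarrow> 0" by simp
    have "Cauchy (\<lambda>n. g n x)"
    proof (rule metric_CauchyI)
      fix e :: real assume "e > 0"
      then obtain M where M: "r M * h x < e/2"
        using order_tendstoD(2)[OF r', of "e/2"] by (auto simp: eventually_sequentially)
      have "dist (g m x) (g n x) < e" if "m \<ge> M" "n \<ge> M" for m n
        using cauchy[OF that(1) x] cauchy[OF that(2) x] M by (simp add: dist_real_def)
      then show "\<exists>M. \<forall>m\<ge>M. \<forall>n\<ge>M. dist (g m x) (g n x) < e" by blast
    qed
    then show ?thesis using Cauchy_convergent convergent_def by blast
  qed
  then obtain l where l: "\<And>x. x \<in> topspace X \<Longrightarrow> (\<lambda>n. g n x) \<longlonglongrightarrow> l x" by metis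
  have le: "\<bar>l x - g m x\<bar> \<le> r m * h x" if x: "x \<in> topspace X" for m x
  proof (rule tendsto_upperbound)
    show "(\<lambda>n. \<bar>g n x - g m x\<bar>) \<longlonglongrightarrow> \<bar>l x - g m x\<bar>" by (intro tendsto_intros l x)
    show "\<forall>\<^sub>F n in sequentially. \<bar>g n x - g m x\<bar> \<le> r m * h x"
      using cauchy[OF _ x] by (auto simp: eventually_sequentially)
  qed simp
  have hpos: "h x > 0" if "x \<in> topspace X" for x using h(2)[OF that] by linarith
  have "continuous_map X Met_TC.mtopology (\<lambda>x. l x / h x)"
  proof (rule Met_TC.continuous_map_uniform_limit[where F=sequentially and f="\<lambda>n x. g n x / h x"])
    show "\<forall>\<^sub>F n in sequentially. continuous_map X Met_TC.mtopology (\<lambda>x. g n x / h x)"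
      using continuous_functionsD(1)[OF g] continuous_functionsD(1)[OF h(1)] hpos
      by (auto intro!: always_eventually continuous_map_real_divide less_imp_neq[symmetric])
    fix e :: real assume "e > 0"
    have "\<bar>g n x / h x - l x / h x\<bar> < e" if "r n < e" "x \<in> topspace X" for n x
    proof -
      have "\<bar>g n x / h x - l x / h x\<bar> = \<bar>l x - g n x\<bar> / h x"
        using hpos[OF that(2)] by (simp flip: diff_divide_distrib add: abs_minus_commute)
      also have "\<dots> \<le> r n" using le[OF that(2), of n] hpos[OF that(2)] by (simp add: divide_le_eq)
      finally show ?thesis using that(1) by simp
    qed
    then show "\<forall>\<^sub>F n in sequentially. \<forall>x\<in>topspace X. l x / h x \<in> UNIV \<and> dist (g n x / h x) (l x / h x) < e"
      using order_tendstoD(2)[OF r \<open>e > 0\<close>] by (auto simp: dist_real_def elim: eventually_mono)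
  qed simp
  then have "continuous_map X euclideanreal (\<lambda>x. (l x / h x) * h x)"
    using continuous_functionsD(1)[OF h(1)] by (intro continuous_map_real_mult) auto
  then have "continuous_map X euclideanreal l"
    by (rule continuous_map_eq) (use hpos in force)
  then show thesis
    using that[OF zero_extension_in[of X l]] le by simp
qed

text \<open>Iterating the escape step gives nested order neighbourhoods, the one of index \<open>Suc n\<close> avoiding
  \<open>B\<close> scaled by \<open>Suc n\<close>.  Their common point would not be absorbed by \<open>B\<close>.\<close>
lemma barrel_absorbs_order_interval:
  assumes B: "barrel (C_k X) B"
    and h: "h \<in> continuous_functions X" "\<And>x. x \<in> topspace X \<Longrightarrow> 1 \<le> h x"
  shows "\<exists>n. \<forall>f\<in>continuous_functions X.
           (\<forall>x\<in>topspace X. \<bar>f x\<bar> \<le> h x) \<longrightarrow> f /\<^sub>R real (Suc n) \<in> B"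
proof (rule ccontr)
  assume "\<not> ?thesis"
  then have unabsorbed: "\<exists>f\<in>continuous_functions X.
      (\<forall>x\<in>topspace X. \<bar>f x\<bar> \<le> h x) \<and> f /\<^sub>R real (Suc n) \<notin> B" for n by blast
  let ?P = "\<lambda>p :: ('a \<Rightarrow> real) \<times> real. fst p \<in> continuous_functions X \<and> 0 < snd p"
  let ?Q = "\<lambda>n (p :: ('a \<Rightarrow> real) \<times> real) q. snd q \<le> snd p / 2 \<and>
    (\<forall>x\<in>topspace X. \<bar>fst q x - fst p x\<bar> \<le> snd p / 2 * h x) \<and>
    (\<forall>u\<in>continuous_functions X. (\<forall>x\<in>topspace X. \<bar>u x - fst q x\<bar> \<le> snd q * h x) \<longrightarrow>
       u /\<^sub>R real (Suc n) \<notin> B)"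
  have "\<exists>s. \<forall>n. ?P (s n) \<and> ?Q n (s n) (s (Suc n))"
  proof (rule dependent_nat_choice)
    show "\<exists>p. ?P p"
      by (rule exI[of _ "(0, 1)"]) (use subspace_0[OF subspace_continuous_functions] in auto)
    fix p n assume "?P p"
    then obtain g' r' where "g' \<in> continuous_functions X" "0 < r'" "r' \<le> snd p / 2"
      "\<And>x. x \<in> topspace X \<Longrightarrow> \<bar>g' x - fst p x\<bar> \<le> snd p / 2 * h x"
      "\<And>u. u \<in> continuous_functions X \<Longrightarrow> (\<And>x. x \<in> topspace X \<Longrightarrow> \<bar>u x - g' x\<bar> \<le> r' * h x) \<Longrightarrow>
       u /\<^sub>R real (Suc n) \<notin> B"
      using barrel_escape_step[OF B h(1) unabsorbed, of "fst p" "snd p" n] by metis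
    then show "\<exists>q. ?P q \<and> ?Q n p q"
      by (intro exI[of _ "(g', r')"]) auto
  qed
  then obtain s where s: "\<And>n. ?P (s n)" "\<And>n. ?Q n (s n) (s (Suc n))" by blast
  define g r where "g = (\<lambda>n. fst (s n))" and "r = (\<lambda>n. snd (s n))"
  have g: "g n \<in> continuous_functions X" and r: "r n > 0" "r (Suc n) \<le> r n / 2"
    and step: "\<And>x. x \<in> topspace X \<Longrightarrow> \<bar>g (Suc n) x - g n x\<bar> \<le> r n / 2 * h x"
    and avoid: "\<And>u. u \<in> continuous_functions X \<Longrightarrow>
      (\<And>x. x \<in> topspace X \<Longrightarrow> \<bar>u x - g (Suc n) x\<bar> \<le> r (Suc n) * h x) \<Longrightarrow>
      u /\<^sub>R real (Suc n) \<notin> B" for n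
    using s unfolding g_def r_def by blast+
  have "r n \<le> r 0 * (1/2) ^ n" for n
  proof (induction n)
    case (Suc n) then show ?case using r(2)[of n] by simp
  qed simp
  moreover have "(\<lambda>n. r 0 * (1/2) ^ n) \<longlonglongrightarrow> 0"
    by (intro tendsto_mult_right_zero LIMSEQ_realpow_zero) auto
  ultimately have r0: "r \<longlonglongrightarrow> 0"
    using r(1) by (intro tendsto_sandwich[OF _ _ tendsto_const, of 0 r]) (auto intro!: always_eventually less_imp_le)
  have hpos: "h x > 0" if "x \<in> topspace X" for x using h(2)[OF that] by linarith
  \<comment> \<open>Subtracting \<open>r n\<close> leaves room for the later steps, which makes the induction work.\<close>
  have cauchy: "\<bar>g n x - g m x\<bar> \<le> (r m - r n) * h x" if "m \<le> n" "x \<in> topspace X" for m n x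
    using that(1)
  proof (induction n rule: dec_induct)
    case (step n)
    have "\<bar>g (Suc n) x - g m x\<bar> \<le> (r m - r n) * h x + r n / 2 * h x"
      using step.IH \<open>\<And>n x. x \<in> topspace X \<Longrightarrow> \<bar>g (Suc n) x - g n x\<bar> \<le> r n / 2 * h x\<close>[OF that(2), of n]
      by linarith
    also have "\<dots> \<le> (r m - r (Suc n)) * h x"
      using mult_right_mono[OF r(2)[of n] less_imp_le[OF hpos[OF that(2)]]] by (simp add: algebra_simps)
    finally show ?case .
  qed simp
  have "\<bar>g n x - g m x\<bar> \<le> r m * h x" if "m \<le> n" "x \<in> topspace X" for m n x
  proof -
    have "(r m - r n) * h x \<le> r m * h x"
      using r(1)[of n] hpos[OF that(2)] by (intro mult_right_mono) auto
    then show ?thesis using cauchy[OF that] by linarith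
  qed
  then obtain u where u: "u \<in> continuous_functions X"
    "\<And>m x. x \<in> topspace X \<Longrightarrow> \<bar>u x - g m x\<bar> \<le> r m * h x"
    using continuous_functions_weighted_limit[where g=g, OF h g r0] by blast
  have "absorbs B {u}" using B u(1) by (simp add: barrel_def)
  then obtain n where "u /\<^sub>R real (Suc n) \<in> B" using absorbs_point by blast
  with avoid[OF u(1) u(2)] show False by blast
qed

section \<open>The support of a barrel\<close>

lemma sum_fun_apply: "(\<Sum>i\<in>I. f i) y = (\<Sum>i\<in>I. f i y :: real)"
  by (induction I rule: infinite_finite_induct) auto

definition barrel_support :: "'a topology \<Rightarrow> ('a \<Rightarrow> real) set \<Rightarrow> 'a set" where
  "barrel_support X B = {x \<in> topspace X. \<forall>U. openin X U \<and> x \<in> U \<longrightarrow>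
     (\<exists>f\<in>continuous_functions X. (\<forall>y. y \<notin> U \<longrightarrow> f y = 0) \<and> f \<notin> B)}"

lemma closedin_barrel_support: "closedin X (barrel_support X B)"
proof -
  have "topspace X - barrel_support X B =
      \<Union>{U. openin X U \<and> (\<forall>f\<in>continuous_functions X. (\<forall>y. y \<notin> U \<longrightarrow> f y = 0) \<longrightarrow> f \<in> B)}"
    (is "_ = \<Union>?\<U>")
    unfolding barrel_support_def by (auto dest: openin_subset)
  moreover have "openin X (\<Union>?\<U>)" by (rule openin_Union) blast
  ultimately show ?thesis by (simp add: closedin_def barrel_support_def)
qed

definition functionally_bounded :: "'a topology \<Rightarrow> 'a set \<Rightarrow> bool" where
  "functionally_bounded X A \<longleftrightarrow> (\<forall>h\<in>continuous_functions X. \<exists>c. \<forall>x\<in>A. \<bar>h x\<bar> \<le> c)"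

text \<open>On the open set where \<open>k < m\<close> only the first \<open>m\<close> terms survive.\<close>
lemma continuous_map_locally_finite_sum:
  fixes k :: "'a \<Rightarrow> real" and \<phi> :: "nat \<Rightarrow> 'a \<Rightarrow> real"
  assumes k: "continuous_map X euclideanreal k"
    and \<phi>: "\<And>n. continuous_map X euclideanreal (\<phi> n)"
    and supp: "\<And>n x. x \<in> topspace X \<Longrightarrow> k x \<le> real n \<Longrightarrow> \<phi> n x = 0"
  obtains H where "continuous_map X euclideanreal H"
    "\<And>x m. x \<in> topspace X \<Longrightarrow> k x \<le> real m \<Longrightarrow> H x = (\<Sum>n<m. \<phi> n x)"
proof -
  define H where "H x = (\<Sum>n<nat \<lceil>k x\<rceil>. \<phi> n x)" for x
  have H: "H x = (\<Sum>n<m. \<phi> n x)" if "x \<in> topspace X" "k x \<le> real m" for x m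
    unfolding H_def
  proof (rule sum.mono_neutral_left)
    show "{..<nat \<lceil>k x\<rceil>} \<subseteq> {..<m}" using that(2) by (auto simp: nat_le_iff ceiling_le_iff)
    show "\<forall>i\<in>{..<m} - {..<nat \<lceil>k x\<rceil>}. \<phi> i x = 0"
    proof
      fix i assume "i \<in> {..<m} - {..<nat \<lceil>k x\<rceil>}"
      then have "k x \<le> real i" by (simp add: not_less nat_le_iff ceiling_le_iff)
      then show "\<phi> i x = 0" by (rule supp[OF that(1)])
    qed
  qed simp
  have "continuous_map X euclideanreal H"
  proof (rule pasting_lemma[where I=UNIV and T="\<lambda>m::nat. {x \<in> topspace X. k x \<in> {..<real m}}"
        and f="\<lambda>m x. \<Sum>n<m. \<phi> n x"])
    show "openin X {x \<in> topspace X. k x \<in> {..<real m}}" for m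
      by (rule openin_continuous_map_preimage[OF k]) simp
    show "continuous_map (subtopology X {x \<in> topspace X. k x \<in> {..<real m}}) euclideanreal
        (\<lambda>x. \<Sum>n<m. \<phi> n x)" for m
      by (intro continuous_map_sum continuous_map_from_subtopology \<phi>) simp
    show "(\<Sum>n<i. \<phi> n x) = (\<Sum>n<j. \<phi> n x)"
      if "x \<in> topspace X \<inter> {x \<in> topspace X. k x \<in> {..<real i}} \<inter> {x \<in> topspace X. k x \<in> {..<real j}}"
      for i j x
      using H[of x i] H[of x j] that by (auto simp: less_imp_le)
    show "\<exists>j. j \<in> UNIV \<and> x \<in> {x \<in> topspace X. k x \<in> {..<real j}} \<and> H x = (\<Sum>n<j. \<phi> n x)"
      if "x \<in> topspace X" for x
    proof -
      obtain j :: nat where "k x < real j" using reals_Archimedean2 by blast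
      then show ?thesis using H[OF that, of j] that by auto
    qed
  qed
  then show thesis using that H by blast
qed

text \<open>If \<open>h\<close> is unbounded on the support, there are functions \<open>f n\<close> outside \<open>B\<close> that vanish
  where \<open>\<bar>h\<bar> \<le> n\<close>.  They form a locally finite family, so the sum of all
  \<open>Suc n * \<bar>f n\<bar>\<close> is a continuous function \<open>H\<close>.  As \<open>B\<close> absorbs the order interval
  of \<open>H\<close>, it contains one of the \<open>f n\<close>.\<close>
lemma functionally_bounded_barrel_support:
  assumes B: "barrel (C_k X) B"
  shows "functionally_bounded X (barrel_support X B)"
  unfolding functionally_bounded_def
proof (intro ballI, rule ccontr)
  fix h assume h: "h \<in> continuous_functions X"
    and unb: "\<nexists>c. \<forall>x\<in>barrel_support X B. \<bar>h x\<bar> \<le> c"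
  define k where "k = (\<lambda>x. \<bar>h x\<bar>)"
  have k: "continuous_map X euclideanreal k"
    unfolding k_def by (intro continuous_map_real_abs continuous_functionsD(1)[OF h])
  have "\<exists>f\<in>continuous_functions X. (\<forall>x\<in>topspace X. k x \<le> real n \<longrightarrow> f x = 0) \<and> f \<notin> B" for n :: nat
  proof -
    obtain p where p: "p \<in> barrel_support X B" "real n < k p"
      using unb unfolding k_def by (meson not_le)
    have "openin X {x \<in> topspace X. k x \<in> {real n<..}}"
      by (rule openin_continuous_map_preimage[OF k]) simp
    moreover have "p \<in> {x \<in> topspace X. k x \<in> {real n<..}}"
      using p by (auto simp: barrel_support_def)
    ultimately obtain f where "f \<in> continuous_functions X" "f \<notin> B"
      "\<forall>y. y \<notin> {x \<in> topspace X. k x \<in> {real n<..}} \<longrightarrow> f y = 0"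
      using p(1) unfolding barrel_support_def by blast
    then show ?thesis by (intro bexI[of _ f]) auto
  qed
  then obtain f where f: "\<And>n. f n \<in> continuous_functions X" "\<And>n. f n \<notin> B"
    "\<And>n x. x \<in> topspace X \<Longrightarrow> k x \<le> real n \<Longrightarrow> f n x = 0" by metis
  define \<phi> where "\<phi> = (\<lambda>n x. real (Suc n) * \<bar>f n x\<bar>)"
  have \<phi>: "continuous_map X euclideanreal (\<phi> n)" for n
    unfolding \<phi>_def
    by (intro continuous_map_real_mult continuous_map_real_abs continuous_functionsD(1)[OF f(1)]) simp
  have \<phi>0: "\<phi> n x = 0" if "x \<in> topspace X" "k x \<le> real n" for n x
    using f(3)[OF that] by (simp add: \<phi>_def)
  obtain H where H: "continuous_map X euclideanreal H"
    "\<And>x m. x \<in> topspace X \<Longrightarrow> k x \<le> real m \<Longrightarrow> H x = (\<Sum>n<m. \<phi> n x)"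
    using continuous_map_locally_finite_sum[of X k \<phi>, OF k \<phi> \<phi>0] by blast
  have le: "\<phi> n x \<le> H x" if x: "x \<in> topspace X" for n x
  proof -
    obtain j :: nat where "k x < real j" using reals_Archimedean2 by blast
    then have "H x = (\<Sum>n<max j (Suc n). \<phi> n x)" using H(2)[OF x, of "max j (Suc n)"] by simp
    moreover have "\<phi> n x \<le> (\<Sum>n<max j (Suc n). \<phi> n x)"
      by (rule member_le_sum) (auto simp: \<phi>_def)
    ultimately show ?thesis by simp
  qed
  let ?H = "zero_extension X (\<lambda>x. 1 + H x)"
  have "continuous_map X euclideanreal (\<lambda>x. 1 + H x)"
    by (intro continuous_map_add H) simp
  then have HC: "?H \<in> continuous_functions X" by (rule zero_extension_in)
  have H1: "1 \<le> ?H x" if x: "x \<in> topspace X" for x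
    using le[OF x, of 0] x by (simp add: \<phi>_def)
  obtain n where n: "\<And>g. g \<in> continuous_functions X \<Longrightarrow>
      (\<And>x. x \<in> topspace X \<Longrightarrow> \<bar>g x\<bar> \<le> ?H x) \<Longrightarrow> g /\<^sub>R real (Suc n) \<in> B"
    using barrel_absorbs_order_interval[OF B HC H1] by blast
  have "(real (Suc n) *\<^sub>R f n) /\<^sub>R real (Suc n) \<in> B"
  proof (rule n)
    show "real (Suc n) *\<^sub>R f n \<in> continuous_functions X" by (rule continuous_functions_scaleR[OF f(1)])
    show "\<bar>(real (Suc n) *\<^sub>R f n) x\<bar> \<le> ?H x" if "x \<in> topspace X" for x
      using le[OF that, of n] that by (simp add: \<phi>_def abs_mult)
  qed
  then have "f n \<in> B" by (simp del: of_nat_Suc)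
  with f(2) show False by blast
qed

text \<open>On a given compact set \<open>K\<close> a partition of unity writes \<open>g\<close> as an average of functions each
  of which vanishes outside a neighbourhood of some point off the support; if the neighbourhoods are
  small enough, these functions belong to \<open>B\<close>.  So \<open>g\<close> agrees on \<open>K\<close> with an element of \<open>B\<close>, and \<open>B\<close> is
  closed.\<close>
lemma barrel_contains_vanishing_near_support:
  assumes X: "completely_regular_space X" and B: "barrel (C_k X) B"
    and G: "openin X G" "barrel_support X B \<subseteq> G"
    and g: "g \<in> continuous_functions X" "\<And>x. x \<in> G \<Longrightarrow> g x = 0"
  shows "g \<in> B"
proof (rule ccontr)
  assume "g \<notin> B"
  then obtain K e where K: "compactin X K" "e > 0" "tube X K e g \<inter> B = {}"
    using barrel_C_k_separate[OF B g(1)] by blast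
  note B' = barrel_C_kD[OF B]
  have KX: "K \<subseteq> topspace X" using compactin_subset_topspace[OF K(1)] .
  define bump where "bump x U \<psi> \<longleftrightarrow> openin X U \<and> continuous_map X euclideanreal \<psi> \<and>
      (\<forall>y\<in>topspace X. 0 \<le> \<psi> y) \<and> \<psi> x = 1 \<and> (\<forall>y\<in>topspace X - U. \<psi> y = 0) \<and>
      (\<forall>f\<in>continuous_functions X. (\<forall>y. y \<notin> U \<longrightarrow> f y = 0) \<longrightarrow> f \<in> B)" for x U and \<psi> :: "'a \<Rightarrow> real"
  have "\<exists>U \<psi>. bump x U \<psi>" if "x \<in> K - G" for x
  proof -
    have "x \<in> topspace X" "x \<notin> barrel_support X B" using that KX G(2) by auto
    then obtain U where U: "openin X U" "x \<in> U"
       "\<forall>f\<in>continuous_functions X. (\<forall>y. y \<notin> U \<longrightarrow> f y = 0) \<longrightarrow> f \<in> B"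
      unfolding barrel_support_def by blast
    have "closedin X (topspace X - U)" using U(1) by blast
    moreover have "x \<in> topspace X - (topspace X - U)" using U \<open>x \<in> topspace X\<close> by blast
    ultimately obtain \<psi> where \<psi>: "continuous_map X (top_of_set {0..1::real}) \<psi>"
        "\<psi> x = 0" "\<psi> ` (topspace X - U) \<subseteq> {1}"
      using X unfolding completely_regular_space_def by metis
    then have c: "continuous_map X euclideanreal \<psi>" "\<psi> ` topspace X \<subseteq> {0..1}"
      by (auto simp: continuous_map_in_subtopology)
    have "continuous_map X euclideanreal (\<lambda>y. 1 - \<psi> y)"
      by (intro continuous_map_diff c) simp
    moreover have "\<forall>y\<in>topspace X. 0 \<le> 1 - \<psi> y" using c(2) by auto
    ultimately show ?thesis using U \<psi> unfolding bump_def by (intro exI[of _ U] exI[of _ "\<lambda>y. 1 - \<psi> y"]) auto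
  qed
  then obtain U \<psi> where "\<And>x. x \<in> K - G \<Longrightarrow> bump x (U x) (\<psi> x)" by metis
  then have U: "\<And>x. x \<in> K - G \<Longrightarrow> openin X (U x)"
    "\<And>x f. x \<in> K - G \<Longrightarrow> f \<in> continuous_functions X \<Longrightarrow> (\<And>y. y \<notin> U x \<Longrightarrow> f y = 0) \<Longrightarrow> f \<in> B"
    and \<psi>: "\<And>x. x \<in> K - G \<Longrightarrow> continuous_map X euclideanreal (\<psi> x)"
    "\<And>x y. x \<in> K - G \<Longrightarrow> y \<in> topspace X \<Longrightarrow> 0 \<le> \<psi> x y"
    "\<And>x. x \<in> K - G \<Longrightarrow> \<psi> x x = (1::real)"
    "\<And>x y. x \<in> K - G \<Longrightarrow> y \<in> topspace X - U x \<Longrightarrow> \<psi> x y = 0"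
    unfolding bump_def by blast+
  define V where "V x = {y \<in> topspace X. \<psi> x y \<in> {1/2<..}}" for x
  have "compactin X (K \<inter> (topspace X - G))"
    using K(1) G(1) by (intro compact_Int_closedin) auto
  moreover have "K \<inter> (topspace X - G) = K - G" using KX by blast
  ultimately have "compactin X (K - G)" by simp
  moreover have "\<And>W. W \<in> V ` (K - G) \<Longrightarrow> openin X W"
    unfolding V_def by (auto intro!: openin_continuous_map_preimage \<psi>(1) simp del: greaterThan_iff)
  moreover have "K - G \<subseteq> \<Union>(V ` (K - G))" using \<psi>(3) KX by (auto simp: V_def)
  ultimately obtain \<F> where "finite \<F>" "\<F> \<subseteq> V ` (K - G)" "K - G \<subseteq> \<Union>\<F>"
    unfolding compactin_def by metis
  then obtain F where F: "finite F" "F \<subseteq> K - G" "K - G \<subseteq> (\<Union>x\<in>F. V x)"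
    by (metis finite_subset_image)
  define \<Psi> where "\<Psi> y = (\<Sum>x\<in>F. \<psi> x y)" for y
  have \<Psi>c: "continuous_map X euclideanreal \<Psi>"
    unfolding \<Psi>_def using F by (intro continuous_map_sum \<psi>) auto
  have \<Psi>: "1/2 \<le> \<Psi> y" if y: "y \<in> K - G" for y
  proof -
    obtain x where x: "x \<in> F" "y \<in> V x" using F(3) y by blast
    have "\<psi> x y \<le> \<Psi> y" unfolding \<Psi>_def
      using F x y KX by (intro member_le_sum \<psi>(2)) auto
    then show ?thesis using x by (auto simp: V_def)
  qed
  \<comment> \<open>The maximum keeps the denominator positive off \<open>K - G\<close>; the factor \<open>card F\<close> compensates for
    taking an average instead of a sum.\<close>
  define \<phi> where "\<phi> x = zero_extension X (\<lambda>y. real (card F) * (\<psi> x y / max (\<Psi> y) (1/2) * g y))" for x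
  have \<phi>C: "\<phi> x \<in> continuous_functions X" if "x \<in> F" for x
    unfolding \<phi>_def using that F(2) \<Psi>c continuous_functionsD(1)[OF g(1)]
    by (intro zero_extension_in continuous_map_real_mult continuous_map_real_divide
          continuous_map_real_max \<psi>(1)) auto
  have \<phi>B: "\<phi> x \<in> B" if "x \<in> F" for x
  proof (rule U(2)[OF _ \<phi>C[OF that]])
    show "x \<in> K - G" using F that by blast
    show "\<phi> x y = 0" if "y \<notin> U x" for y
      using \<psi>(4)[OF \<open>x \<in> K - G\<close>, of y] that by (simp add: \<phi>_def zero_extension_def)
  qed
  have "0 \<in> B"
  proof -
    have "absorbs B {0}" using B subspace_0[OF subspace_continuous_functions, of X] by (simp add: barrel_def)
    then show ?thesis using absorbs_point[of B 0] by simp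
  qed
  define g' where "g' = (\<Sum>x\<in>F. inverse (real (card F)) *\<^sub>R \<phi> x)"
  have "g' \<in> B"
  proof (cases "F = {}")
    case True then show ?thesis using \<open>0 \<in> B\<close> by (simp add: g'_def)
  next
    case False
    then show ?thesis unfolding g'_def using F \<phi>B B'(1)
      by (intro convex_sum) auto
  qed
  moreover have "g' \<in> continuous_functions X" using \<open>g' \<in> B\<close> B'(3) by blast
  moreover have "g' y = g y" if y: "y \<in> K" for y
  proof -
    have yX: "y \<in> topspace X" using y KX by blast
    have "g' y = (\<Sum>x\<in>F. inverse (real (card F)) * \<phi> x y)"
      by (simp add: g'_def sum_fun_apply)
    also have "\<dots> = (\<Sum>x\<in>F. \<psi> x y * (g y / max (\<Psi> y) (1/2)))"
    proof (rule sum.cong)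
      fix x assume "x \<in> F"
      then have "card F \<noteq> 0" using F(1) by auto
      then show "inverse (real (card F)) * \<phi> x y = \<psi> x y * (g y / max (\<Psi> y) (1/2))"
        using yX by (simp add: \<phi>_def)
    qed simp
    also have "\<dots> = \<Psi> y * (g y / max (\<Psi> y) (1/2))"
      unfolding \<Psi>_def by (rule sum_distrib_right[symmetric])
    also have "\<dots> = g y"
    proof (cases "y \<in> G")
      case True then show ?thesis using g(2) by simp
    next
      case False
      then have "1/2 \<le> \<Psi> y" using \<Psi> y by blast
      then show ?thesis by (simp add: max_def)
    qed
    finally show ?thesis .
  qed
  ultimately have "g' \<in> tube X K e g" using K(2) by (simp add: tube_def)
  then show False using K(3) \<open>g' \<in> B\<close> by blast
qed

text \<open>Truncate \<open>f\<close> at a small height \<open>d\<close>: the truncation lies in a multiple of the unit order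
  interval, which \<open>B\<close> absorbs, and the remainder vanishes near the support.  So \<open>f\<close> is the midpoint
  of two elements of \<open>B\<close>.\<close>
lemma barrel_contains_tube_on_support:
  assumes X: "completely_regular_space X" and B: "barrel (C_k X) B"
  obtains e where "e > 0" "tube X (barrel_support X B) e 0 \<subseteq> B"
proof -
  note B' = barrel_C_kD[OF B]
  have "zero_extension X (\<lambda>x. 1) \<in> continuous_functions X" by (rule zero_extension_in) simp
  then obtain n where "\<forall>f\<in>continuous_functions X.
      (\<forall>x\<in>topspace X. \<bar>f x\<bar> \<le> zero_extension X (\<lambda>x. 1) x) \<longrightarrow> f /\<^sub>R real (Suc n) \<in> B"
    using barrel_absorbs_order_interval[OF B, of "zero_extension X (\<lambda>x. 1)"] by fastforce
  then have n: "g /\<^sub>R real (Suc n) \<in> B"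
    if "g \<in> continuous_functions X" "\<And>x. x \<in> topspace X \<Longrightarrow> \<bar>g x\<bar> \<le> 1" for g
    using that by (simp del: of_nat_Suc)
  define d where "d = 1 / (2 * real (Suc n))"
  have d: "d > 0" by (simp add: d_def)
  have "f \<in> B" if f: "f \<in> tube X (barrel_support X B) (d/2) 0" for f
  proof -
    have fC: "f \<in> continuous_functions X" "\<And>x. x \<in> barrel_support X B \<Longrightarrow> \<bar>f x\<bar> \<le> d/2"
      using f by (auto simp: tube_def)
    define f1 where "f1 = (\<lambda>x. max (-d) (min d (f x)))"
    have "f1 \<in> continuous_functions X"
      using fC(1) d unfolding f1_def continuous_functions_def
      by (auto intro!: continuous_map_real_max continuous_map_real_min)
    have "((2 * real (Suc n)) *\<^sub>R f1) /\<^sub>R real (Suc n) \<in> B"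
    proof (rule n)
      show "(2 * real (Suc n)) *\<^sub>R f1 \<in> continuous_functions X"
        by (rule continuous_functions_scaleR) fact
      have "\<bar>f1 x\<bar> \<le> d" for x using d by (auto simp: f1_def)
      then show "\<bar>((2 * real (Suc n)) *\<^sub>R f1) x\<bar> \<le> 1" for x
        by (simp add: d_def abs_mult field_simps del: of_nat_Suc)
    qed
    moreover have "inverse (real (Suc n)) * (2 * real (Suc n)) = 2" by (simp del: of_nat_Suc)
    ultimately have 1: "2 *\<^sub>R f1 \<in> B" by (simp only: scaleR_scaleR)
    define G where "G = {x \<in> topspace X. f x \<in> {-d<..<d}}"
    have 2: "2 *\<^sub>R (f - f1) \<in> B"
    proof (rule barrel_contains_vanishing_near_support[OF X B])
      show "openin X G" unfolding G_def
        by (rule openin_continuous_map_preimage[OF continuous_functionsD(1)[OF fC(1)]]) simp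
      show "barrel_support X B \<subseteq> G"
        using fC(2) d by (force simp: G_def barrel_support_def)
      show "2 *\<^sub>R (f - f1) \<in> continuous_functions X"
        by (intro continuous_functions_scaleR continuous_functions_diff) fact+
      show "(2 *\<^sub>R (f - f1)) x = 0" if "x \<in> G" for x
        using that by (auto simp: G_def f1_def)
    qed
    have "(1/2) *\<^sub>R (2 *\<^sub>R f1) + (1/2) *\<^sub>R (2 *\<^sub>R (f - f1)) \<in> B"
      using B'(1) 1 2 by (intro convexD) auto
    then show "f \<in> B" by simp
  qed
  then have "tube X (barrel_support X B) (d/2) 0 \<subseteq> B" by blast
  then show thesis using that[of "d/2"] d by simp
qed

section \<open>Functionally bounded sets in the bornological case\<close>

text \<open>Membership of \<open>L\<close> in the closure of the evaluations at points of \<open>A\<close>, for pointwise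
  convergence on \<open>continuous_functions X\<close>.  For functionally bounded \<open>A\<close> in a Tychonoff space these
  are the evaluations at the points of the closure of \<open>A\<close> in the Stone-Cech compactification.\<close>
definition pointwise_limit_functional ::
    "'a topology \<Rightarrow> 'a set \<Rightarrow> (('a \<Rightarrow> real) \<Rightarrow> real) \<Rightarrow> bool" where
  "pointwise_limit_functional X A L \<longleftrightarrow>
     (\<forall>F e. finite F \<and> F \<subseteq> continuous_functions X \<and> e > 0 \<longrightarrow>
        (\<exists>a\<in>A. \<forall>f\<in>F. \<bar>f a - L f\<bar> < e))"

lemma pointwise_limit_functionalD:
  assumes "pointwise_limit_functional X A L" "finite F" "F \<subseteq> continuous_functions X" "e > 0"
  obtains a where "a \<in> A" "\<And>f. f \<in> F \<Longrightarrow> \<bar>f a - L f\<bar> < e"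
proof -
  have "\<exists>a\<in>A. \<forall>f\<in>F. \<bar>f a - L f\<bar> < e"
    using assms unfolding pointwise_limit_functional_def by simp
  then show thesis using that by blast
qed

lemma pointwise_limit_functional_add:
  assumes L: "pointwise_limit_functional X A L"
    and f: "f \<in> continuous_functions X" and g: "g \<in> continuous_functions X"
  shows "L (f + g) = L f + L g"
proof (rule ccontr)
  assume "\<not> ?thesis"
  then have d: "\<bar>L (f + g) - (L f + L g)\<bar> / 3 > 0" (is "?d > 0") by simp
  have sub: "{f, g, f + g} \<subseteq> continuous_functions X" using f g continuous_functions_add by blast
  obtain a where a: "a \<in> A" "\<And>h. h \<in> {f, g, f + g} \<Longrightarrow> \<bar>h a - L h\<bar> < ?d"
    by (rule pointwise_limit_functionalD[OF L _ sub d]) simp_all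
  show False
    using a(2)[of f] a(2)[of g] a(2)[of "f + g"] by (simp add: field_simps abs_if split: if_splits)
qed

lemma pointwise_limit_functional_scaleR:
  assumes L: "pointwise_limit_functional X A L" and f: "f \<in> continuous_functions X"
  shows "L (c *\<^sub>R f) = c * L f"
proof (rule ccontr)
  assume "\<not> ?thesis"
  then have d: "\<bar>L (c *\<^sub>R f) - c * L f\<bar> / (1 + \<bar>c\<bar>) > 0" (is "?d > 0") by simp
  have sub: "{f, c *\<^sub>R f} \<subseteq> continuous_functions X" using f continuous_functions_scaleR by blast
  obtain a where a: "a \<in> A" "\<And>h. h \<in> {f, c *\<^sub>R f} \<Longrightarrow> \<bar>h a - L h\<bar> < ?d"
    by (rule pointwise_limit_functionalD[OF L _ sub d]) simp_all
  have 1: "\<bar>c * f a - L (c *\<^sub>R f)\<bar> < ?d" and 2: "\<bar>f a - L f\<bar> < ?d"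
    using a(2)[of f] a(2)[of "c *\<^sub>R f"] by simp_all
  have "\<bar>L (c *\<^sub>R f) - c * L f\<bar> \<le> \<bar>c * f a - L (c *\<^sub>R f)\<bar> + \<bar>c * (f a - L f)\<bar>"
    by (simp add: algebra_simps)
  also have "\<dots> < ?d + \<bar>c\<bar> * ?d"
    using 1 mult_left_mono[OF less_imp_le[OF 2] abs_ge_zero[of c]]
    unfolding abs_mult by (rule add_less_le_mono)
  also have "\<dots> = (1 + \<bar>c\<bar>) * ?d" by (simp only: distrib_right mult_1)
  also have "\<dots> = \<bar>L (c *\<^sub>R f) - c * L f\<bar>" by simp
  finally show False by simp
qed

text \<open>Countably many zero sets through a point of the realcompactification have a common point in the
  space.  Concretely: the series \<open>g\<close> of the truncated deviations
  \<open>min 1 \<bar>f n - L (f n)\<bar>\<close> comes arbitrarily close to \<open>0\<close> on \<open>A\<close>.  If \<open>g\<close> had no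
  zero, its inverse would be a continuous function unbounded on \<open>A\<close>.\<close>
lemma pointwise_limit_functional_sequence:
  fixes f :: "nat \<Rightarrow> 'a \<Rightarrow> real"
  assumes A: "A \<subseteq> topspace X" "functionally_bounded X A"
    and L: "pointwise_limit_functional X A L" and f: "\<And>n. f n \<in> continuous_functions X"
  shows "\<exists>x\<in>topspace X. \<forall>n. f n x = L (f n)"
proof (rule ccontr)
  assume neg: "\<not> ?thesis"
  define \<gamma> where "\<gamma> n x = (1/2) ^ n * min 1 \<bar>f n x - L (f n)\<bar>" for n x
  define g where "g x = (\<Sum>n. \<gamma> n x)" for x
  have \<gamma>: "0 \<le> \<gamma> n x" "\<gamma> n x \<le> (1/2) ^ n" "\<gamma> n x \<le> \<bar>f n x - L (f n)\<bar>" for n x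
  proof -
    show "0 \<le> \<gamma> n x" by (simp add: \<gamma>_def)
    have "\<gamma> n x \<le> (1/2) ^ n * 1" unfolding \<gamma>_def by (intro mult_left_mono) auto
    then show "\<gamma> n x \<le> (1/2) ^ n" by simp
    have "\<gamma> n x \<le> 1 * \<bar>f n x - L (f n)\<bar>" unfolding \<gamma>_def
      by (intro mult_mono) (auto simp: power_le_one)
    then show "\<gamma> n x \<le> \<bar>f n x - L (f n)\<bar>" by simp
  qed
  have geom: "summable (\<lambda>n. (1/2 :: real) ^ n)" by (rule summable_geometric) simp
  have summ: "summable (\<lambda>n. \<gamma> n x)" for x
    by (rule summable_comparison_test'[OF geom, of 0]) (use \<gamma> in simp)
  have lim: "uniform_limit (topspace X) (\<lambda>n x. \<Sum>i<n. \<gamma> i x) g sequentially"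
    unfolding g_def by (rule Weierstrass_m_test[OF _ geom]) (use \<gamma> in simp)
  have "continuous_map X Met_TC.mtopology g"
  proof (rule Met_TC.continuous_map_uniform_limit[where F=sequentially and f="\<lambda>n x. \<Sum>i<n. \<gamma> i x"])
    show "\<forall>\<^sub>F n in sequentially. continuous_map X Met_TC.mtopology (\<lambda>x. \<Sum>i<n. \<gamma> i x)"
      unfolding \<gamma>_def using continuous_functionsD(1)[OF f]
      by (intro always_eventually allI)
         (auto intro!: continuous_map_sum continuous_map_real_mult_left continuous_map_real_min
           continuous_map_real_abs continuous_map_diff)
    show "\<forall>\<^sub>F n in sequentially. \<forall>x\<in>topspace X. g x \<in> UNIV \<and> dist (\<Sum>i<n. \<gamma> i x) (g x) < e"
      if "e > 0" for e
      using uniform_limitD[OF lim that] by simp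
  qed simp
  then have gc: "continuous_map X euclideanreal g" by simp
  have gpos: "g x > 0" if x: "x \<in> topspace X" for x
  proof -
    obtain n where "f n x \<noteq> L (f n)" using neg x by blast
    then have "\<gamma> n x > 0" by (simp add: \<gamma>_def)
    then show ?thesis unfolding g_def using suminf_pos2[OF summ, of x n] \<gamma>(1) by blast
  qed
  have "continuous_map X euclideanreal (\<lambda>x. inverse (g x))"
    using gc gpos by (intro continuous_map_real_inverse) (auto dest: gpos)
  then have "zero_extension X (\<lambda>x. inverse (g x)) \<in> continuous_functions X" by blast
  then obtain c where c: "\<And>a. a \<in> A \<Longrightarrow> \<bar>zero_extension X (\<lambda>x. inverse (g x)) a\<bar> \<le> c"
    using A(2) unfolding functionally_bounded_def by blast
  define d where "d = inverse (max 1 c)"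
  have d: "d > 0" by (simp add: d_def)
  have ga: "g a \<ge> d" if "a \<in> A" for a
  proof -
    have "a \<in> topspace X" using that A by blast
    then have "inverse (g a) \<le> max 1 c" using c[OF that] gpos[OF \<open>a \<in> topspace X\<close>] by auto
    then show ?thesis unfolding d_def
      using gpos[OF \<open>a \<in> topspace X\<close>] by (metis inverse_inverse_eq inverse_positive_iff_positive le_imp_inverse_le)
  qed
  obtain N where N: "\<And>x. x \<in> topspace X \<Longrightarrow> \<bar>(\<Sum>i<N. \<gamma> i x) - g x\<bar> < d / 2"
    using uniform_limitD[OF lim, of "d/2"] d by (auto simp: eventually_sequentially dist_real_def)
  have sub: "f ` {..<N} \<subseteq> continuous_functions X" using f by blast
  have d': "d / (2 * (real N + 1)) > 0" using d by simp
  obtain a where a: "a \<in> A" "\<And>h. h \<in> f ` {..<N} \<Longrightarrow> \<bar>h a - L h\<bar> < d / (2 * (real N + 1))"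
    by (rule pointwise_limit_functionalD[OF L finite_imageI[OF finite_lessThan] sub d']) simp
  have "(\<Sum>i<N. \<gamma> i a) \<le> (\<Sum>i<N. d / (2 * (real N + 1)))"
  proof (rule sum_mono)
    fix i assume "i \<in> {..<N}"
    then show "\<gamma> i a \<le> d / (2 * (real N + 1))" using a(2)[of "f i"] \<gamma>(3)[of i a] by simp
  qed
  also have "\<dots> = (real N / (real N + 1)) * (d / 2)" by (simp add: field_simps)
  also have "\<dots> \<le> 1 * (d / 2)" using d by (intro mult_right_mono) auto
  finally show False using ga[OF a(1)] N[of a] a(1) A(1) unfolding abs_less_iff by auto
qed

lemma bornological_bounded_functional_nbhd:
  assumes born: "bornological (C_k X)"
    and add: "\<And>f g. f \<in> continuous_functions X \<Longrightarrow> g \<in> continuous_functions X \<Longrightarrow> L (f + g) = L f + L g"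
    and scale: "\<And>c f. f \<in> continuous_functions X \<Longrightarrow> L (c *\<^sub>R f) = c * L f"
    and bdd: "\<And>M. tvs_bounded (C_k X) M \<Longrightarrow> \<exists>b. \<forall>f\<in>M. \<bar>L f\<bar> \<le> b"
  shows "nbhd_of_zero (C_k X) {f \<in> continuous_functions X. \<bar>L f\<bar> \<le> (1::real)}" (is "nbhd_of_zero _ ?W")
proof -
  have "convex ?W"
  proof (rule convexI)
    fix f g and u v :: real assume "f \<in> ?W" "g \<in> ?W" and uv: "0 \<le> u" "0 \<le> v" "u + v = 1"
    then have f: "f \<in> continuous_functions X" "\<bar>L f\<bar> \<le> 1" and g: "g \<in> continuous_functions X" "\<bar>L g\<bar> \<le> 1"
      by auto
    have "L (u *\<^sub>R f + v *\<^sub>R g) = u * L f + v * L g"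
      using f g by (simp add: add scale continuous_functions_scaleR)
    moreover have "\<bar>u * L f + v * L g\<bar> \<le> 1"
    proof -
      have "\<bar>u * L f + v * L g\<bar> \<le> \<bar>u * L f\<bar> + \<bar>v * L g\<bar>" by (rule abs_triangle_ineq)
      also have "\<dots> = u * \<bar>L f\<bar> + v * \<bar>L g\<bar>" using uv by (simp add: abs_mult)
      also have "\<dots> \<le> 1" using convex_bound_le[of "\<bar>L f\<bar>" 1 "\<bar>L g\<bar>" u v] f g uv by simp
      finally show ?thesis .
    qed
    ultimately show "u *\<^sub>R f + v *\<^sub>R g \<in> ?W"
      using f g by (simp add: continuous_functions_add continuous_functions_scaleR)
  qed
  moreover have "balanced ?W"
    unfolding balanced_def by (auto simp: scale continuous_functions_scaleR abs_mult mult_le_one)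
  moreover have "bornivorous (C_k X) ?W"
    unfolding bornivorous_def
  proof (intro conjI allI impI)
    fix M assume M: "tvs_bounded (C_k X) M"
    then obtain b where b: "\<And>f. f \<in> M \<Longrightarrow> \<bar>L f\<bar> \<le> b" using bdd by blast
    have MC: "M \<subseteq> continuous_functions X" using M by (simp add: tvs_bounded_def)
    have "M \<subseteq> (\<lambda>x. c *\<^sub>R x) ` ?W" if c: "max 1 b \<le> \<bar>c\<bar>" for c
    proof
      fix f assume f: "f \<in> M"
      have c0: "c \<noteq> 0" using c by auto
      have "\<bar>L (inverse c *\<^sub>R f)\<bar> = \<bar>L f\<bar> / \<bar>c\<bar>"
        using f MC by (simp add: scale subset_iff abs_mult divide_inverse mult.commute)
      also have "\<dots> \<le> 1" using b[OF f] c c0 by simp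
      finally have "inverse c *\<^sub>R f \<in> ?W" using f MC continuous_functions_scaleR by auto
      moreover have "f = c *\<^sub>R (inverse c *\<^sub>R f)" using c0 by simp
      ultimately show "f \<in> (\<lambda>x. c *\<^sub>R x) ` ?W" by blast
    qed
    then show "absorbs ?W M"
      unfolding absorbs_def by (intro exI[of _ "max 1 b"]) auto
  qed simp
  ultimately show ?thesis
    using born unfolding bornological_def absolutely_convex_def by blast
qed

text \<open>A sequence in a bounded set along which \<open>L\<close> is unbounded would be unbounded at a single point.
  So \<open>L\<close> is bounded on bounded sets, hence continuous by the bornological property: a compact
  \<open>K\<close> controls it.  If \<open>L\<close> were no evaluation at a point of \<open>K\<close>, finitely many functions would witness
  this, and one could build from them a function \<open>G\<close> that vanishes on \<open>K\<close> with \<open>L G\<close> near \<open>1\<close>.\<close>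
lemma bornological_limit_functional_evaluation:
  assumes born: "bornological (C_k X)" and A: "A \<subseteq> topspace X" "functionally_bounded X A"
    and L: "pointwise_limit_functional X A L"
  obtains x where "x \<in> topspace X" "\<And>f. f \<in> continuous_functions X \<Longrightarrow> L f = f x"
proof -
  have "nbhd_of_zero (C_k X) {f \<in> continuous_functions X. \<bar>L f\<bar> \<le> (1::real)}"
  proof (rule bornological_bounded_functional_nbhd[OF born])
    fix M assume M: "tvs_bounded (C_k X) M"
    show "\<exists>b. \<forall>f\<in>M. \<bar>L f\<bar> \<le> b"
    proof (rule ccontr)
      assume "\<not> ?thesis"
      then have "\<forall>n. \<exists>f\<in>M. real n < \<bar>L f\<bar>" by (meson not_le)
      then obtain f where f: "\<And>n. f n \<in> M" "\<And>n. real n < \<bar>L (f n)\<bar>" by metis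
      have "f n \<in> continuous_functions X" for n using f(1) M by (auto simp: tvs_bounded_def)
      then obtain x where x: "x \<in> topspace X" "\<And>n. f n x = L (f n)"
        using pointwise_limit_functional_sequence[OF A L, of f] by blast
      have "nbhd_of_zero (C_k X) (tube X {x} 1 0)"
        unfolding nbhd_of_zero_C_k using x(1)
        by (intro conjI exI[of _ "{x}"] exI[of _ "1::real"]) (auto simp: tube_def)
      then obtain r where r: "r > 0" "\<And>c. \<bar>c\<bar> \<ge> r \<Longrightarrow> M \<subseteq> (\<lambda>x. c *\<^sub>R x) ` tube X {x} 1 0"
        using M unfolding tvs_bounded_def absorbs_def by meson
      obtain n where n: "r \<le> real n" using real_arch_simple by blast
      have "f n \<in> (\<lambda>x. r *\<^sub>R x) ` tube X {x} 1 0" using r(2)[of r] r(1) f(1)[of n] by auto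
      then have "\<bar>f n x\<bar> \<le> r" using r(1) by (auto simp: tube_def abs_mult)
      then show False using x(2) f(2)[of n] n by simp
    qed
  qed (use pointwise_limit_functional_add[OF L] pointwise_limit_functional_scaleR[OF L] in blast)+
  then obtain K e where K: "compactin X K" "e > 0"
    "tube X K e 0 \<subseteq> {f \<in> continuous_functions X. \<bar>L f\<bar> \<le> 1}"
    unfolding nbhd_of_zero_C_k by blast
  have KX: "K \<subseteq> topspace X" using compactin_subset_topspace[OF K(1)] .
  have "\<exists>x\<in>K. \<forall>f\<in>continuous_functions X. L f = f x"
  proof (rule ccontr)
    assume "\<not> ?thesis"
    then obtain \<phi> where \<phi>: "\<And>x. x \<in> K \<Longrightarrow> \<phi> x \<in> continuous_functions X"
      "\<And>x. x \<in> K \<Longrightarrow> L (\<phi> x) \<noteq> \<phi> x x" by metis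
    define \<delta> where "\<delta> x = \<bar>\<phi> x x - L (\<phi> x)\<bar> / 2" for x
    have \<delta>: "\<delta> x > 0" if "x \<in> K" for x using \<phi>(2)[OF that] by (simp add: \<delta>_def)
    define \<rho> where "\<rho> x y = \<bar>\<phi> x y - L (\<phi> x)\<bar> / \<delta> x" for x y
    have \<rho>c: "continuous_map X euclideanreal (\<rho> x)" if "x \<in> K" for x
      unfolding \<rho>_def divide_inverse using continuous_functionsD(1)[OF \<phi>(1)[OF that]]
      by (intro continuous_map_real_mult continuous_map_real_abs continuous_map_diff) auto
    define V where "V x = {y \<in> topspace X. \<rho> x y \<in> {1<..}}" for x
    have "\<And>W. W \<in> V ` K \<Longrightarrow> openin X W"
      unfolding V_def by (auto intro!: openin_continuous_map_preimage \<rho>c simp del: greaterThan_iff)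
    moreover have "\<rho> x x = 2" if "x \<in> K" for x using \<delta>[OF that] by (simp add: \<rho>_def \<delta>_def)
    then have "K \<subseteq> \<Union>(V ` K)" using KX by (auto simp: V_def)
    ultimately obtain \<F> where "finite \<F>" "\<F> \<subseteq> V ` K" "K \<subseteq> \<Union>\<F>"
      using K(1) unfolding compactin_def by metis
    then obtain F where F: "finite F" "F \<subseteq> K" "K \<subseteq> (\<Union>x\<in>F. V x)"
      by (metis finite_subset_image)
    have \<rho>0: "0 \<le> \<rho> x y" if "x \<in> F" for x y
      using \<delta> that F(2) by (force simp: \<rho>_def)
    \<comment> \<open>Each \<open>\<rho> x\<close> exceeds \<open>1\<close> on \<open>V x\<close>, so \<open>G\<close> vanishes on \<open>K\<close>; near the limit all
      \<open>\<rho> x\<close> are small, so \<open>G\<close> is close to \<open>1\<close>.\<close>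
    define G where "G = zero_extension X (\<lambda>y. max 0 (1 - (\<Sum>x\<in>F. \<rho> x y)))"
    have GC: "G \<in> continuous_functions X"
      unfolding G_def using F(1,2) \<rho>c
      by (intro zero_extension_in continuous_map_real_max continuous_map_diff continuous_map_sum) auto
    have "G y = 0" if y: "y \<in> K" for y
    proof -
      obtain x where x: "x \<in> F" "y \<in> V x" using F(3) y by blast
      have "\<rho> x y \<le> (\<Sum>x\<in>F. \<rho> x y)" by (intro member_le_sum F x \<rho>0) auto
      moreover have "1 < \<rho> x y" using x by (auto simp: V_def)
      ultimately show ?thesis by (simp add: G_def zero_extension_def)
    qed
    then have "2 *\<^sub>R G \<in> tube X K e 0"
      using K(2) continuous_functions_scaleR[OF GC] by (simp add: tube_def)
    then have "\<bar>L (2 *\<^sub>R G)\<bar> \<le> 1" using K(3) by blast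
    then have LG: "\<bar>L G\<bar> \<le> 1/2" using pointwise_limit_functional_scaleR[OF L GC, of 2] by simp
    define s where "s = (\<Sum>x\<in>F. inverse (\<delta> x))"
    have s: "s \<ge> 0" unfolding s_def using F(2) \<delta> by (intro sum_nonneg) (force intro: less_imp_le)
    define \<epsilon> where "\<epsilon> = 1 / (4 * (1 + s))"
    have \<epsilon>: "\<epsilon> > 0" "\<epsilon> \<le> 1/4" "\<epsilon> * s \<le> 1/4" using s by (auto simp: \<epsilon>_def field_simps)
    have sub: "insert G (\<phi> ` F) \<subseteq> continuous_functions X" using GC \<phi>(1) F(2) by blast
    obtain a where a: "a \<in> A" "\<And>h. h \<in> insert G (\<phi> ` F) \<Longrightarrow> \<bar>h a - L h\<bar> < \<epsilon>"
      by (rule pointwise_limit_functionalD[OF L finite.insertI[OF finite_imageI[OF F(1)]] sub \<epsilon>(1)]) simp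
    have "(\<Sum>x\<in>F. \<rho> x a) \<le> (\<Sum>x\<in>F. \<epsilon> * inverse (\<delta> x))"
    proof (rule sum_mono)
      fix x assume x: "x \<in> F"
      then have "\<delta> x > 0" using \<delta> F(2) by blast
      then show "\<rho> x a \<le> \<epsilon> * inverse (\<delta> x)"
        unfolding \<rho>_def divide_inverse using a(2)[of "\<phi> x"] x by (intro mult_right_mono) auto
    qed
    also have "\<dots> \<le> 1/4" using \<epsilon>(3) by (simp add: s_def sum_distrib_left)
    finally have "G a \<ge> 3/4" using a(1) A(1) by (simp add: G_def zero_extension_def subset_iff)
    then show False using a(2)[of G] LG \<epsilon>(2) by simp
  qed
  then show thesis using that KX by blast
qed

lemma completely_regular_bump:
  assumes "completely_regular_space X" "closedin X C" "x \<in> topspace X - C"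
  obtains f where "f \<in> continuous_functions X" "f x = 0" "\<And>y. y \<in> C \<Longrightarrow> f y = 1"
proof -
  obtain f :: "'a \<Rightarrow> real" where f: "continuous_map X euclideanreal f" "f x = 0" "f ` C \<subseteq> {1}"
    using assms unfolding completely_regular_space_alt by blast
  have "zero_extension X f y = 1" if "y \<in> C" for y
    using f(3) that closedin_subset[OF assms(2)] by (auto simp: zero_extension_def)
  then show thesis using that[OF zero_extension_in[OF f(1)]] f(2) assms(3) by simp
qed

text \<open>Evaluation embeds \<open>A\<close> into a product of compact intervals.  Every point of the closure \<open>Z\<close> of the
  image is again the evaluation at a point of \<open>A\<close>, so the image is compact, and complete regularity
  carries open covers of \<open>A\<close> over to \<open>Z\<close>.\<close>
lemma bornological_closed_functionally_bounded_compact: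
  assumes X: "completely_regular_space X" and born: "bornological (C_k X)"
    and A: "closedin X A" "functionally_bounded X A"
  shows "compactin X A"
proof -
  have AX: "A \<subseteq> topspace X" using closedin_subset[OF A(1)] .
  let ?C = "continuous_functions X"
  obtain c where c: "\<And>h x. h \<in> ?C \<Longrightarrow> x \<in> A \<Longrightarrow> \<bar>h x\<bar> \<le> c h"
    using A(2) unfolding functionally_bounded_def by metis
  define P where "P = product_topology (\<lambda>f. top_of_set {- c f..c f}) ?C"
  define ev where "ev a = restrict (\<lambda>f. f a) ?C" for a
  have "compact_space P"
    unfolding P_def by (simp add: compact_space_product_topology compact_space_subtopology)
  define Z where "Z = P closure_of (ev ` A)"
  have Zc: "compactin P Z"
    unfolding Z_def by (rule closedin_compact_space[OF \<open>compact_space P\<close>]) simp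
  have evP: "ev a \<in> topspace P" if "a \<in> A" for a
    using c[OF _ that] by (fastforce simp: P_def ev_def abs_le_iff)
  then have evZ: "ev a \<in> Z" if "a \<in> A" for a
    unfolding Z_def using closure_of_subset[of "ev ` A" P] that by blast
  have proj: "openin P {p \<in> topspace P. p f \<in> U}" if "f \<in> ?C" "open U" for f U
  proof -
    have "continuous_map P (top_of_set {- c f..c f}) (\<lambda>p. p f)"
      unfolding P_def by (rule continuous_map_product_projection[OF that(1)])
    then have "continuous_map P euclideanreal (\<lambda>p. p f)" by (simp add: continuous_map_in_subtopology)
    from openin_continuous_map_preimage[OF this, of U] that(2) show ?thesis by simp
  qed
  have limit: "pointwise_limit_functional X A L" if LZ: "L \<in> Z" for L
    unfolding pointwise_limit_functional_def
  proof (intro allI impI, elim conjE)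
    fix F :: "('a \<Rightarrow> real) set" and e :: real
    assume F: "finite F" "F \<subseteq> ?C" "e > 0"
    define T where "T = {p \<in> topspace P. \<forall>f\<in>F. p f \<in> ball (L f) e}"
    have "openin P T"
      unfolding T_def using F(1,2)
    proof (induction F)
      case (insert f F)
      have "{p \<in> topspace P. \<forall>g\<in>insert f F. p g \<in> ball (L g) e} =
          {p \<in> topspace P. p f \<in> ball (L f) e} \<inter> {p \<in> topspace P. \<forall>f\<in>F. p f \<in> ball (L f) e}" by blast
      then show ?case using insert proj[of f "ball (L f) e"] by (simp add: openin_Int)
    qed simp
    moreover have "L \<in> topspace P"
      using LZ closure_of_subset_topspace[of P] unfolding Z_def by blast
    then have "L \<in> T" using F(3) by (simp add: T_def)
    ultimately obtain p where "p \<in> ev ` A" "p \<in> T"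
      using LZ unfolding Z_def in_closure_of by blast
    then obtain a where "a \<in> A" "ev a \<in> T" by blast
    then have "a \<in> A" "\<forall>f\<in>F. ev a f \<in> ball (L f) e" by (simp_all add: T_def)
    then show "\<exists>a\<in>A. \<forall>f\<in>F. \<bar>f a - L f\<bar> < e"
      using F(2) by (intro bexI[where x=a]) (auto simp: ev_def dist_real_def abs_minus_commute subset_iff)
  qed
  have point: "\<exists>x\<in>A. \<forall>f\<in>?C. L f = f x" if LZ: "L \<in> Z" for L
  proof -
    obtain x where x: "x \<in> topspace X" "\<And>f. f \<in> ?C \<Longrightarrow> L f = f x"
      using bornological_limit_functional_evaluation[OF born AX A(2) limit[OF LZ]] by blast
    have "x \<in> A"
    proof (rule ccontr)
      assume "x \<notin> A"
      then obtain f where f: "f \<in> ?C" "f x = 0" "\<And>y. y \<in> A \<Longrightarrow> f y = 1"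
        using completely_regular_bump[OF X A(1)] x(1) by blast
      obtain a where "a \<in> A" "\<bar>f a - L f\<bar> < 1"
        by (rule pointwise_limit_functionalD[OF limit[OF LZ], of "{f}" 1]) (use f(1) in simp_all)
      then show False using f x(2)[OF f(1)] by simp
    qed
    then show ?thesis using x(2) by blast
  qed
  show ?thesis
    unfolding compactin_def
  proof (intro conjI AX allI impI, elim conjE)
    fix \<U> assume \<U>: "Ball \<U> (openin X)" "A \<subseteq> \<Union>\<U>"
    have "\<exists>U f. U \<in> \<U> \<and> f \<in> ?C \<and> f a = 0 \<and> (\<forall>y\<in>topspace X - U. f y = 1)" if a: "a \<in> A" for a
    proof -
      obtain U where U: "U \<in> \<U>" "a \<in> U" using \<U>(2) a by blast
      then have "closedin X (topspace X - U)" "a \<in> topspace X - (topspace X - U)"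
        using \<U>(1) a AX by auto
      then show ?thesis using completely_regular_bump[OF X] U(1) by metis
    qed
    then obtain U \<phi> where U: "\<And>a. a \<in> A \<Longrightarrow> U a \<in> \<U>" and \<phi>: "\<And>a. a \<in> A \<Longrightarrow> \<phi> a \<in> ?C"
      "\<And>a. a \<in> A \<Longrightarrow> \<phi> a a = 0" "\<And>a y. a \<in> A \<Longrightarrow> y \<in> topspace X - U a \<Longrightarrow> \<phi> a y = 1"
      by metis
    define V where "V a = {p \<in> topspace P. p (\<phi> a) \<in> {..<1}}" for a
    have "\<And>W. W \<in> V ` A \<Longrightarrow> openin P W" using proj[OF \<phi>(1) open_lessThan] unfolding V_def by auto
    moreover have "Z \<subseteq> \<Union>(V ` A)"
    proof
      fix L assume "L \<in> Z"
      then obtain x where "x \<in> A" "\<And>f. f \<in> ?C \<Longrightarrow> L f = f x" using point by blast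
      moreover have "L \<in> topspace P"
        using \<open>L \<in> Z\<close> closure_of_subset_topspace[of P] unfolding Z_def by blast
      ultimately show "L \<in> \<Union>(V ` A)" using \<phi>(1,2)
        by (auto simp: V_def intro!: bexI[of _ x])
    qed
    ultimately obtain \<F> where "finite \<F>" "\<F> \<subseteq> V ` A" "Z \<subseteq> \<Union>\<F>"
      using Zc unfolding compactin_def by metis
    then obtain F where F: "finite F" "F \<subseteq> A" "Z \<subseteq> (\<Union>x\<in>F. V x)"
      by (metis finite_subset_image)
    have "A \<subseteq> \<Union>(U ` F)"
    proof
      fix b assume b: "b \<in> A"
      then obtain a where a: "a \<in> F" "ev b \<in> V a" using F(3) evZ by blast
      then have "\<phi> a b < 1" using \<phi>(1) F(2) by (auto simp: V_def ev_def subset_iff)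
      then have "b \<in> U a" using \<phi>(3)[of a b] a(1) F(2) b AX by force
      then show "b \<in> \<Union>(U ` F)" using a(1) by blast
    qed
    then show "\<exists>\<F>. finite \<F> \<and> \<F> \<subseteq> \<U> \<and> A \<subseteq> \<Union>\<F>"
      using F U by (intro exI[of _ "U ` F"]) auto
  qed
qed

theorem bornological_C_k_imp_barrelled:
  assumes X: "completely_regular_space X" and born: "bornological (C_k X)"
  shows "barrelled (C_k X)"
  unfolding barrelled_def
proof (intro conjI allI impI)
  show "locally_convex_space (C_k X)" using born by (simp add: bornological_def)
  fix B assume B: "barrel (C_k X) B"
  have "compactin X (barrel_support X B)"
    using bornological_closed_functionally_bounded_compact[OF X born
        closedin_barrel_support functionally_bounded_barrel_support[OF B]] .
  moreover obtain e where "e > 0" "tube X (barrel_support X B) e 0 \<subseteq> B"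
    using barrel_contains_tube_on_support[OF X B] .
  ultimately show "nbhd_of_zero (C_k X) B"
    unfolding nbhd_of_zero_C_k using barrel_C_kD(3)[OF B] by blast
qed

section \<open>Local quasi-convexity of spaces of continuous functions\<close>

lemma C_k_continuous_evaluation:
  assumes "x \<in> topspace X"
  shows "continuous_map (C_k X) euclideanreal (\<lambda>f. f x)"
  unfolding continuous_map_def
proof (intro conjI allI impI)
  fix U :: "real set" assume "openin euclideanreal U"
  then have "open U" by simp
  moreover have "compactin X {x}" using assms by simp
  moreover have *: "{f \<in> topspace (C_k X). f x \<in> U} = {f \<in> continuous_functions X. f ` {x} \<subseteq> U}" by auto
  ultimately have "openin (C_k X) {f \<in> continuous_functions X. f ` {x} \<subseteq> U}"
    unfolding C_k_def
    by (intro topology_generated_by_Basis CollectI exI[of _ "{x}"] exI[of _ U] conjI refl)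
  with * show "openin (C_k X) {f \<in> topspace (C_k X). f x \<in> U}" by (simp only:)
qed simp

definition evaluation_character :: "'a topology \<Rightarrow> 'a \<Rightarrow> real \<Rightarrow> ('a \<Rightarrow> real) \<Rightarrow> complex" where
  "evaluation_character X x c = restrict (\<lambda>f. cis (c * f x)) (continuous_functions X)"

lemma evaluation_character_in_dual_group:
  assumes "x \<in> topspace X"
  shows "evaluation_character X x c \<in> dual_group (C_k X)"
proof -
  have "continuous_map euclideanreal euclidean (\<lambda>t. cis (c * t))"
    by (simp add: continuous_on_cis continuous_intros)
  then have "continuous_map (C_k X) euclidean (\<lambda>f. cis (c * f x))"
    using continuous_map_compose[OF C_k_continuous_evaluation[OF assms]] unfolding o_def by blast
  then have "continuous_map (C_k X) (top_of_set circle) (\<lambda>f. cis (c * f x))"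
    by (auto simp: continuous_map_in_subtopology circle_def)
  then have "continuous_map (C_k X) (top_of_set circle) (evaluation_character X x c)"
    by (rule continuous_map_eq) (simp add: evaluation_character_def)
  moreover have "evaluation_character X x c (f + g) =
      evaluation_character X x c f * evaluation_character X x c g"
    if "f \<in> continuous_functions X" "g \<in> continuous_functions X" for f g
    using that continuous_functions_add[OF that]
    by (simp add: evaluation_character_def cis_mult distrib_left)
  ultimately show ?thesis
    by (simp add: dual_group_def evaluation_character_def)
qed

lemma cis_in_circle_plus_iff: "cis t \<in> circle_plus \<longleftrightarrow> 0 \<le> cos t"
  by (simp add: circle_plus_def circle_def)

text \<open>A function \<open>g\<close> outside the tube has \<open>\<bar>g x\<bar> > e\<close> for some \<open>x\<close> in \<open>K\<close>.  The
  evaluation at \<open>x\<close>, scaled to put \<open>\<bar>g x\<bar>\<close> strictly beyond \<open>pi / 2\<close> but \<open>e\<close> at most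
  there, separates \<open>g\<close> from the tube.\<close>
lemma tube_quasi_convex:
  assumes K: "compactin X K" and e: "e > 0"
  shows "quasi_convex (C_k X) (tube X K e 0)"
  unfolding quasi_convex_def
proof (intro conjI ballI)
  show "tube X K e 0 \<subseteq> topspace (C_k X)" by (auto simp: tube_def)
  fix g assume "g \<in> topspace (C_k X) - tube X K e 0"
  then obtain x where g: "g \<in> continuous_functions X" and x: "x \<in> K" "e < \<bar>g x\<bar>"
    by (auto simp: tube_def)
  have xX: "x \<in> topspace X" using x compactin_subset_topspace[OF K] by blast
  \<comment> \<open>The second bound prevents the angle of \<open>g\<close> from running past \<open>pi\<close> and back into the
    right half plane.\<close>
  define c where "c = min (pi / (2 * e)) (pi / \<bar>g x\<bar>)"
  have c: "c > 0" "c * e \<le> pi / 2" "c * \<bar>g x\<bar> \<le> pi" "pi / 2 < c * \<bar>g x\<bar>"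
  proof -
    show "c > 0" using e x(2) by (simp add: c_def)
    have "c * e \<le> pi / (2 * e) * e" using e by (intro mult_right_mono) (auto simp: c_def)
    then show "c * e \<le> pi / 2" using e by simp
    have "c * \<bar>g x\<bar> \<le> pi / \<bar>g x\<bar> * \<bar>g x\<bar>" by (intro mult_right_mono) (auto simp: c_def)
    then show "c * \<bar>g x\<bar> \<le> pi" using e x(2) by simp
    show "pi / 2 < c * \<bar>g x\<bar>"
      using e x(2) by (auto simp: c_def min_def field_simps)
  qed
  have "cos (c * g x) = cos (c * \<bar>g x\<bar>)" by (cases "g x \<ge> 0") auto
  also have "\<dots> < cos (pi / 2)" using c by (intro cos_monotone_0_pi) auto
  finally have "evaluation_character X x c g \<notin> circle_plus"
    using g by (simp add: evaluation_character_def cis_in_circle_plus_iff)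
  moreover have "evaluation_character X x c ` tube X K e 0 \<subseteq> circle_plus"
  proof (intro image_subsetI)
    fix f assume "f \<in> tube X K e 0"
    then have f: "f \<in> continuous_functions X" "\<bar>f x\<bar> \<le> e" using x(1) by (auto simp: tube_def)
    have "c * \<bar>f x\<bar> \<le> pi / 2" using mult_left_mono[OF f(2), of c] c(1,2) by linarith
    then have "\<bar>c * f x\<bar> \<le> pi / 2" using c(1) by (simp add: abs_mult)
    then have "0 \<le> cos (c * f x)" by (intro cos_ge_zero) auto
    then show "evaluation_character X x c f \<in> circle_plus"
      using f(1) by (simp add: evaluation_character_def cis_in_circle_plus_iff)
  qed
  ultimately show "\<exists>\<phi>\<in>dual_group (C_k X). \<phi> g \<notin> circle_plus \<and> \<phi> ` tube X K e 0 \<subseteq> circle_plus"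
    using evaluation_character_in_dual_group[OF xX] by blast
qed

lemma locally_convex_space_imp_topological_abelian_group:
  fixes T :: "'v::real_vector topology"
  assumes "locally_convex_space T"
  shows "topological_abelian_group T"
proof -
  have "continuous_map T (prod_topology euclideanreal T) (\<lambda>x. (-1, x))"
    by (intro continuous_map_pairedI) auto
  moreover have "continuous_map (prod_topology euclideanreal T) T (\<lambda>(c, x). c *\<^sub>R x)"
    using assms by (simp add: locally_convex_space_def)
  ultimately have "continuous_map T T ((\<lambda>(c, x). c *\<^sub>R x) \<circ> (\<lambda>x. (-1, x)))"
    by (rule continuous_map_compose)
  then have "continuous_map T T uminus" by (simp add: o_def)
  then show ?thesis
    using assms by (simp add: locally_convex_space_def topological_abelian_group_def subspace_0)
qed

lemma locally_quasi_convex_C_k: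
  assumes "locally_convex_space (C_k X)"
  shows "locally_quasi_convex (C_k X)"
  unfolding locally_quasi_convex_def MAP_group_def
proof (intro conjI ballI impI)
  show "topological_abelian_group (C_k X)"
    using assms by (rule locally_convex_space_imp_topological_abelian_group)
next
  fix f g assume fg: "f \<in> topspace (C_k X)" "g \<in> topspace (C_k X)" "f \<noteq> g"
  then obtain x where x: "f x \<noteq> g x" by blast
  have xX: "x \<in> topspace X" using fg x by (auto simp: continuous_functions_def)
  define c where "c = pi / (f x - g x)"
  have "c * (f x - g x) = pi" using x by (simp add: c_def)
  then have "c * f x - c * g x = pi" by (simp add: right_diff_distrib)
  then have "cis (c * f x) = cis pi * cis (c * g x)" by (simp add: cis_mult algebra_simps del: cis_pi)
  then have "evaluation_character X x c f \<noteq> evaluation_character X x c g"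
    using fg by (simp add: evaluation_character_def)
  then show "\<exists>\<phi>\<in>dual_group (C_k X). \<phi> f \<noteq> \<phi> g"
    using evaluation_character_in_dual_group[OF xX] by blast
next
  show "neighbourhood_base_at 0 (quasi_convex (C_k X)) (C_k X)"
    unfolding neighbourhood_base_at_def
  proof (intro allI impI, elim conjE)
    fix W assume W: "openin (C_k X) W" "0 \<in> W"
    obtain K e where K: "compactin X K" "e > 0" "tube X K e 0 \<subseteq> W"
      using C_k_open_contains_tube[OF W] .
    have "nbhd_of_zero (C_k X) (tube X K e 0)"
      unfolding nbhd_of_zero_C_k using K by (auto simp: tube_def)
    then obtain U where "openin (C_k X) U" "0 \<in> U" "U \<subseteq> tube X K e 0"
      unfolding nbhd_of_zero_def by blast
    then show "\<exists>U V. openin (C_k X) U \<and> quasi_convex (C_k X) V \<and> 0 \<in> U \<and> U \<subseteq> V \<and> V \<subseteq> W"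
      using K tube_quasi_convex[OF K(1,2)] by blast
  qed
qed

section \<open>Characters of the real line\<close>

lemma additive_continuous_real_linear:
  fixes h :: "real \<Rightarrow> real"
  assumes add: "\<And>s t. h (s + t) = h s + h t" and cont: "continuous_on UNIV h"
  shows "h t = t * h 1"
proof -
  have h0: "h 0 = 0" using add[of 0 0] by simp
  have neg: "h (- t) = - h t" for t using add[of t "- t"] h0 by simp
  have nat: "h (real n * t) = real n * h t" for n t
    by (induction n) (simp_all add: h0 add distrib_right)
  have int: "h (of_int k * t) = of_int k * h t" for k t
    by (cases k) (use nat neg in \<open>simp_all del: of_nat_Suc\<close>)
  have rat: "h q = q * h 1" if rq: "q \<in> \<rat>" for q
  proof -
    obtain m n :: int where q: "q = of_int m / of_int n" "n > 0" by (rule Rats_cases'[OF rq])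
    then have nq: "of_int n * q = of_int m" by simp
    have "of_int n * h q = h (of_int n * q)" by (rule int[symmetric])
    also have "\<dots> = h (of_int m * 1)" by (simp only: nq mult_1_right)
    also have "\<dots> = of_int m * h 1" by (rule int)
    finally have "of_int n * h q = of_int n * (q * h 1)" by (simp flip: nq)
    then show ?thesis using q(2) by simp
  qed
  have "closed {t. h t = t * h 1}"
    by (intro closed_Collect_eq cont continuous_intros)
  then have "closure \<rat> \<subseteq> {t. h t = t * h 1}"
    by (intro closure_minimal subsetI CollectI rat)
  moreover have "t \<in> closure \<rat>" by (simp add: Rats_closure_real)
  ultimately show ?thesis by blast
qed

text \<open>Lift \<open>\<psi>\<close> through the exponential.  The defect of additivity of the lift is continuous with
  values in a discrete set, hence constant, so the normalised lift is additive and therefore linear.\<close>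
lemma real_character:
  fixes \<psi> :: "real \<Rightarrow> complex"
  assumes cont: "continuous_on UNIV \<psi>" and norm: "\<And>t. norm (\<psi> t) = 1"
    and mult: "\<And>s t. \<psi> (s + t) = \<psi> s * \<psi> t"
  obtains s where "\<And>t. \<psi> t = cis (t * s)"
proof -
  have nz: "\<psi> t \<noteq> 0" for t using norm[of t] by auto
  then obtain g where g: "continuous_on UNIV g" "\<And>t. \<psi> t = exp (g t)"
    using continuous_logarithm_on_contractible[OF cont contractible_UNIV nz] by (metis UNIV_I)
  have "\<psi> 0 * \<psi> 0 = \<psi> 0 * 1" using mult[of 0 0] by simp
  then have "\<psi> 0 = 1" using nz[of 0] by simp
  define v where "v t u = g (t + u) - g t - g u + g 0" for t u
  have v0: "v t u = 0" for t u
  proof -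
    have vZ: "\<exists>n. v t y = of_int (2 * n) * pi * \<i>" for y
    proof -
      have "exp (v t y) = exp (g (t + y)) * inverse (exp (g t)) * inverse (exp (g y)) * exp (g 0)"
        by (simp add: v_def exp_add exp_diff divide_inverse)
      also have "\<dots> = 1"
        using \<open>\<psi> 0 = 1\<close> nz[of t] nz[of y] by (simp add: mult g(2)[symmetric] field_simps)
      finally have "exp (v t y) = exp 0" by simp
      then show ?thesis unfolding exp_eq by simp
    qed
    have "v t constant_on UNIV"
    proof (rule continuous_discrete_range_constant)
      have "continuous_on UNIV (\<lambda>u. g (t + u))"
        by (rule continuous_on_compose2[OF g(1)]) (auto intro!: continuous_intros)
      then show "continuous_on UNIV (v t)"
        unfolding v_def using g(1) by (intro continuous_intros) auto
      fix x :: real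
      show "\<exists>e>0. \<forall>y. y \<in> UNIV \<and> v t y \<noteq> v t x \<longrightarrow> e \<le> norm (v t y - v t x)"
      proof (intro exI[of _ 1] conjI allI impI)
        fix y assume ne: "y \<in> UNIV \<and> v t y \<noteq> v t x"
        obtain m n where mn: "v t y = of_int (2 * m) * pi * \<i>" "v t x = of_int (2 * n) * pi * \<i>"
          using vZ[of y] vZ[of x] by (elim exE)
        have "v t y - v t x = of_real (2 * real_of_int (m - n) * pi) * \<i>" by (simp add: mn algebra_simps)
        then have "norm (v t y - v t x) = 2 * \<bar>real_of_int (m - n)\<bar> * pi"
          by (simp only: norm_mult norm_of_real norm_ii abs_mult) simp
        moreover have "m \<noteq> n" using ne mn by auto
        then have "\<bar>real_of_int (m - n)\<bar> \<ge> 1" by linarith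
        then have "2 * \<bar>real_of_int (m - n)\<bar> * pi \<ge> 1 * 1"
          using pi_ge_two by (intro mult_mono) auto
        ultimately show "1 \<le> norm (v t y - v t x)" by simp
      qed simp
    qed simp
    then have "v t u = v t 0" unfolding constant_on_def by (metis UNIV_I)
    then show ?thesis by (simp add: v_def)
  qed
  define h where "h t = Im (g t) - Im (g 0)" for t
  have "h (s + t) = h s + h t" for s t
    using arg_cong[OF v0[of s t], of Im] by (simp add: h_def v_def)
  moreover have "continuous_on UNIV h"
    unfolding h_def using g(1) by (intro continuous_intros)
  ultimately have lin: "h t = t * h 1" for t by (rule additive_continuous_real_linear)
  have "\<psi> t = cis (t * h 1)" for t
  proof -
    have re: "Re (g t) = 0" for t using norm[of t] by (simp add: g(2))
    have c: "\<psi> t = cis (Im (g t))" for t using exp_eq_polar[of "g t"] re[of t] by (simp add: g(2))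
    have "cis (Im (g t)) = cis (h t) * cis (Im (g 0))" by (simp add: h_def cis_mult)
    also have "cis (Im (g 0)) = 1" using c[of 0] \<open>\<psi> 0 = 1\<close> by simp
    finally show ?thesis using c[of t] lin[of t] by simp
  qed
  then show thesis using that by blast
qed

lemma cis_line_inject:
  assumes "\<And>t. cis (t * s) = cis (t * s')"
  shows "s = s'"
proof (rule ccontr)
  assume "s \<noteq> s'"
  define t where "t = pi / (s - s')"
  have "t * (s - s') = pi" using \<open>s \<noteq> s'\<close> by (simp add: t_def)
  then have "cis (t * s) = cis (t * s') * cis pi"
    by (simp add: cis_mult algebra_simps del: cis_pi)
  then show False using assms[of t] by simp
qed

text \<open>Nested intervals: on a window \<open>[u n, u n + pi / a n]\<close> with
  \<open>u n * a n\<close> congruent to \<open>pi / 2\<close> modulo \<open>2 * pi\<close> the cosine of \<open>t * a n\<close> is nonpositive.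
  Such a window contains one for the next frequency, because it lasts half a period and the next
  frequency is at least three times as large.\<close>
lemma lacunary_cos_nonpos:
  fixes a :: "nat \<Rightarrow> real"
  assumes a: "\<And>n. a n > 0" "\<And>n. a (Suc n) \<ge> 3 * a n"
  obtains t where "0 < t" "t \<le> 2 * pi / a 0" "\<And>n. cos (t * a n) \<le> 0"
proof -
  let ?P = "\<lambda>n u. 0 < u \<and> (\<exists>j::int. u * a n = pi / 2 + 2 * pi * of_int j)"
  let ?Q = "\<lambda>n u u'. u \<le> u' \<and> u' + pi / a (Suc n) \<le> u + pi / a n"
  have "\<exists>u. \<forall>n. (?P n (u n) \<and> (n = 0 \<longrightarrow> u n = pi / (2 * a 0))) \<and> ?Q n (u n) (u (Suc n))"
  proof (rule dependent_nat_choice)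
    show "\<exists>u. ?P 0 u \<and> (0 = (0::nat) \<longrightarrow> u = pi / (2 * a 0))"
      using a(1)[of 0] by (intro exI[of _ "pi / (2 * a 0)"]) (auto intro!: exI[of _ 0])
    fix u n assume u: "?P n u \<and> (n = 0 \<longrightarrow> u = pi / (2 * a 0))"
    define b where "b = a (Suc n)"
    have b: "b > 0" "b \<ge> 3 * a n" using a unfolding b_def by auto
    define j where "j = \<lceil>(u * b - pi / 2) / (2 * pi)\<rceil>"
    define u' where "u' = (pi / 2 + 2 * pi * of_int j) / b"
    have "(u * b - pi / 2) / (2 * pi) \<le> of_int j" "of_int j < (u * b - pi / 2) / (2 * pi) + 1"
      unfolding j_def by linarith+
    then have 1: "u * b \<le> pi / 2 + 2 * pi * of_int j" "pi / 2 + 2 * pi * of_int j < u * b + 2 * pi"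
      by (simp_all add: field_simps)
    have "u \<le> u'" using 1(1) b by (simp add: u'_def le_divide_eq)
    moreover have "u' + pi / b \<le> u + pi / a n"
    proof -
      have "u' \<le> (u * b + 2 * pi) / b" unfolding u'_def using 1(2) b by (intro divide_right_mono) auto
      also have "\<dots> = u + 2 * (pi / b)" using b by (simp add: field_simps)
      finally have "u' + pi / b \<le> u + 3 * (pi / b)" by simp
      moreover have "3 * pi / b \<le> 3 * pi / (3 * a n)"
        using b a(1)[of n] by (intro divide_left_mono) auto
      ultimately show ?thesis by simp
    qed
    moreover have "u' * b = pi / 2 + 2 * pi * of_int j" using b by (simp add: u'_def)
    ultimately show "\<exists>y. (?P (Suc n) y \<and> (Suc n = 0 \<longrightarrow> y = pi / (2 * a 0))) \<and> ?Q n u y"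
      using u unfolding b_def by (intro exI[of _ u']) auto
  qed
  then obtain u where u: "\<And>n. ?P n (u n)" "u 0 = pi / (2 * a 0)" "\<And>n. ?Q n (u n) (u (Suc n))" by blast
  have inc: "incseq u" using u(3) by (intro incseq_SucI) blast
  have dec: "decseq (\<lambda>n. u n + pi / a n)" using u(3) by (intro decseq_SucI) blast
  have le: "u n \<le> u 0 + pi / a 0" for n
    using decseqD[OF dec, of 0 n] a(1)[of n] by (smt (verit) divide_pos_pos le0 pi_gt_zero)
  obtain t where t: "u \<longlonglongrightarrow> t" "\<forall>n. u n \<le> t" using incseq_convergent[OF inc, of "u 0 + pi / a 0"] le by blast
  have t2: "t \<le> u n + pi / a n" for n
  proof (rule LIMSEQ_le_const2[OF t(1)], intro exI allI impI)
    fix m assume "n \<le> m"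
    then show "u m \<le> u n + pi / a n"
      using decseqD[OF dec, of n m] a(1)[of m] by (smt (verit) divide_pos_pos pi_gt_zero)
  qed
  show thesis
  proof (rule that[of t])
    show "0 < t" using u(1)[of 0] t(2) by (meson less_le_trans)
    have "t \<le> pi / (2 * a 0) + pi / a 0" using t2[of 0] u(2) by simp
    also have "\<dots> \<le> 2 * pi / a 0" using a(1)[of 0] by (simp add: field_simps)
    finally show "t \<le> 2 * pi / a 0" .
    show "cos (t * a n) \<le> 0" for n
    proof -
      obtain j :: int where j: "u n * a n = pi / 2 + 2 * pi * of_int j" using u(1)[of n] by blast
      define w where "w = t * a n - 2 * pi * of_int j"
      have "u n * a n \<le> t * a n" using t(2) a(1)[of n] by (simp add: mult_right_mono)
      then have w1: "pi / 2 \<le> w" by (simp add: w_def j)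
      have "t * a n \<le> (u n + pi / a n) * a n" using t2 a(1)[of n] by (intro mult_right_mono) auto
      also have "\<dots> = u n * a n + pi" using a(1)[of n] by (simp add: field_simps)
      finally have w2: "w \<le> 3 * pi / 2" by (simp add: w_def j)
      have "cos (t * a n) = cos w"
        unfolding w_def by (subst cos.minus_of_int[symmetric, of _ j]) (simp add: mult.commute)
      also have "cos w = - cos (w - pi)" by (simp add: cos_diff)
      also have "\<dots> \<le> 0" using w1 w2 cos_ge_zero[of "w - pi"] by simp
      finally show ?thesis .
    qed
  qed
qed

text \<open>On the right half of the unit circle \<open>norm (z + 1)\<close> is at least \<open>sqrt 2\<close>, so by
  \<open>z ^ 2 - 1 = (z + 1) * (z - 1)\<close> squaring
  increases the distance to \<open>1\<close> at least by that factor.\<close>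
lemma norm_diff_one_le_if_iterated_squares_in_half_plane:
  fixes z :: complex
  assumes "norm z = 1" "\<And>j. j < k \<Longrightarrow> 0 \<le> Re (z ^ (2 ^ j))"
  shows "norm (z - 1) \<le> 2 / sqrt 2 ^ k"
  using assms
proof (induction k arbitrary: z)
  case 0
  then show ?case using norm_triangle_ineq4[of z 1] by simp
next
  case (Suc k)
  have "0 \<le> Re ((z ^ 2) ^ (2 ^ j))" if "j < k" for j
    using Suc.prems(2)[of "Suc j"] that by (simp add: power_mult)
  then have IH: "norm (z ^ 2 - 1) \<le> 2 / sqrt 2 ^ k"
    using Suc.prems(1) by (intro Suc.IH) (auto simp: norm_power)
  have "(norm (z + 1))\<^sup>2 = (norm z)\<^sup>2 + 2 * Re z + 1"
    unfolding cmod_power2 by (simp add: power2_eq_square algebra_simps)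
  then have "(norm (z + 1))\<^sup>2 \<ge> 2" using Suc.prems(1) Suc.prems(2)[of 0] by simp
  then have s2: "sqrt 2 \<le> norm (z + 1)" by (rule real_le_lsqrt[OF norm_ge_zero, simplified])
  have "sqrt 2 * norm (z - 1) \<le> norm (z + 1) * norm (z - 1)" using s2 by (rule mult_right_mono) simp
  also have "\<dots> = norm (z ^ 2 - 1)"
    by (simp add: power2_eq_square algebra_simps flip: norm_mult)
  finally have "sqrt 2 * norm (z - 1) \<le> 2 / sqrt 2 ^ k" using IH by simp
  then show ?case by (simp add: field_simps)
qed

section \<open>Characters of topological abelian groups and locally convex spaces\<close>

lemma topological_abelian_groupD:
  assumes "topological_abelian_group T"
  shows "0 \<in> topspace T"
    and "\<And>x y. x \<in> topspace T \<Longrightarrow> y \<in> topspace T \<Longrightarrow> x + y \<in> topspace T"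
    and "\<And>x. x \<in> topspace T \<Longrightarrow> - x \<in> topspace T"
    and "\<And>a. a \<in> topspace T \<Longrightarrow> continuous_map T T (\<lambda>x. a + x)"
    and "continuous_map T T (\<lambda>x. x + x)"
proof -
  have add: "continuous_map (prod_topology T T) T (\<lambda>(x, y). x + y)"
    and neg: "continuous_map T T uminus" and "0 \<in> topspace T"
    using assms by (auto simp: topological_abelian_group_def)
  show "0 \<in> topspace T" by fact
  show "x + y \<in> topspace T" if "x \<in> topspace T" "y \<in> topspace T" for x y
    using continuous_map_image_subset_topspace[OF add] that by fastforce
  show "- x \<in> topspace T" if "x \<in> topspace T" for x
    using continuous_map_image_subset_topspace[OF neg] that by fastforce
  show "continuous_map T T (\<lambda>x. a + x)" if "a \<in> topspace T" for a
  proof -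
    have "continuous_map T (prod_topology T T) (\<lambda>x. (a, x))"
      using that by (intro continuous_map_pairedI) auto
    from continuous_map_compose[OF this add] show ?thesis by (simp add: o_def)
  qed
  have "continuous_map T (prod_topology T T) (\<lambda>x. (x, x))"
    by (intro continuous_map_pairedI) auto
  from continuous_map_compose[OF this add] show "continuous_map T T (\<lambda>x. x + x)" by (simp add: o_def)
qed

definition circle_hom :: "'g::ab_group_add set \<Rightarrow> ('g \<Rightarrow> complex) \<Rightarrow> bool" where
  "circle_hom E \<phi> \<longleftrightarrow> \<phi> ` E \<subseteq> circle \<and> (\<forall>x\<in>E. \<forall>y\<in>E. \<phi> (x + y) = \<phi> x * \<phi> y)"

lemma circle_homD:
  assumes "circle_hom E \<phi>"
  shows "x \<in> E \<Longrightarrow> norm (\<phi> x) = 1"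
    and "x \<in> E \<Longrightarrow> y \<in> E \<Longrightarrow> \<phi> (x + y) = \<phi> x * \<phi> y"
  using assms by (auto simp: circle_hom_def circle_def)

text \<open>A homomorphism that maps a neighbourhood of zero into the right half of the circle is continuous:
  on smaller neighbourhoods, repeated doubling stays in the given one, so the iterated squares of
  the values stay in the right half plane and force the values towards \<open>1\<close>.\<close>
lemma circle_hom_continuous_if_bounded_near_zero:
  assumes T: "topological_abelian_group T" and \<phi>: "circle_hom (topspace T) \<phi>"
    and U: "openin T U" "0 \<in> U" "\<phi> ` U \<subseteq> circle_plus"
  shows "continuous_map T (top_of_set circle) \<phi>"
proof -
  note T' = topological_abelian_groupD[OF T]
  have half: "\<exists>V. openin T V \<and> 0 \<in> V \<and> (\<forall>x\<in>V. \<forall>j<k. 0 \<le> Re (\<phi> x ^ (2 ^ j)))" for k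
  proof (induction k)
    case 0
    show ?case using U by (intro exI[of _ U]) auto
  next
    case (Suc k)
    then obtain V where V: "openin T V" "0 \<in> V" "\<And>x j. x \<in> V \<Longrightarrow> j < k \<Longrightarrow> 0 \<le> Re (\<phi> x ^ (2 ^ j))"
      by blast
    define W where "W = {x \<in> topspace T. x + x \<in> V} \<inter> U"
    have "openin T W"
      unfolding W_def by (intro openin_Int openin_continuous_map_preimage[OF T'(5) V(1)] U)
    moreover have "0 \<in> W" using V(2) U(2) T'(1) by (simp add: W_def)
    moreover have "0 \<le> Re (\<phi> x ^ (2 ^ j))" if x: "x \<in> W" and j: "j < Suc k" for x j
    proof (cases j)
      case 0
      then show ?thesis using x U(3) by (auto simp: W_def circle_plus_def)
    next
      case (Suc i)
      have "\<phi> (x + x) = (\<phi> x)\<^sup>2"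
        using x circle_homD(2)[OF \<phi>] by (simp add: W_def power2_eq_square)
      then show ?thesis
        using V(3)[of "x + x" i] x j Suc by (simp add: W_def power_mult)
    qed
    ultimately show ?case by blast
  qed
  have small: "\<exists>V. openin T V \<and> 0 \<in> V \<and> (\<forall>x\<in>V. norm (\<phi> x - 1) < e)" if e: "e > 0" for e :: real
  proof -
    have lim: "(\<lambda>k. 2 * inverse (sqrt 2) ^ k) \<longlonglongrightarrow> 0"
      by (intro tendsto_mult_right_zero LIMSEQ_realpow_zero) (auto simp: inverse_less_1_iff)
    obtain k where k: "2 * inverse (sqrt 2) ^ k < e"
      using order_tendstoD(2)[OF lim e] unfolding eventually_sequentially by blast
    obtain V where V: "openin T V" "0 \<in> V" "\<And>x j. x \<in> V \<Longrightarrow> j < k \<Longrightarrow> 0 \<le> Re (\<phi> x ^ (2 ^ j))"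
      using half[of k] by blast
    have "norm (\<phi> x - 1) < e" if "x \<in> V" for x
    proof -
      have "x \<in> topspace T" using that openin_subset[OF V(1)] by blast
      then have "norm (\<phi> x - 1) \<le> 2 / sqrt 2 ^ k"
        by (intro norm_diff_one_le_if_iterated_squares_in_half_plane circle_homD(1)[OF \<phi>] V(3) that)
      also have "\<dots> < e" using k by (simp add: divide_inverse power_inverse)
      finally show ?thesis .
    qed
    then show ?thesis using V(1,2) by blast
  qed
  have "continuous_map T Met_TC.mtopology \<phi>"
    unfolding Met_TC.continuous_map_to_metric
  proof (intro ballI allI impI)
    fix g and e :: real assume g: "g \<in> topspace T" and e: "e > 0"
    obtain V where V: "openin T V" "0 \<in> V" "\<And>x. x \<in> V \<Longrightarrow> norm (\<phi> x - 1) < e"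
      using small[OF e] by blast
    have "openin T {x \<in> topspace T. - g + x \<in> V}"
      by (intro openin_continuous_map_preimage[OF T'(4) V(1)] T'(3) g)
    moreover have "\<phi> x \<in> Met_TC.mball (\<phi> g) e" if x: "x \<in> topspace T" "- g + x \<in> V" for x
    proof -
      have "- g + x \<in> topspace T" by (rule T'(2)[OF T'(3)[OF g] x(1)])
      then have "\<phi> x = \<phi> g * \<phi> (- g + x)"
        using circle_homD(2)[OF \<phi> g] by fastforce
      then have "\<phi> x - \<phi> g = \<phi> g * (\<phi> (- g + x) - 1)" by (simp add: algebra_simps)
      then have "norm (\<phi> x - \<phi> g) = norm (\<phi> (- g + x) - 1)"
        using circle_homD(1)[OF \<phi> g] by (simp add: norm_mult)
      also have "\<dots> < e" using V(3) x by blast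
      finally show ?thesis by (simp add: dist_norm norm_minus_commute)
    qed
    ultimately show "\<exists>W. openin T W \<and> g \<in> W \<and> (\<forall>y\<in>W. \<phi> y \<in> Met_TC.mball (\<phi> g) e)"
      using g V(2) by (intro exI[of _ "{x \<in> topspace T. - g + x \<in> V}"]) auto
  qed
  then show ?thesis
    using \<phi> by (auto simp: continuous_map_in_subtopology circle_hom_def)
qed

lemma dual_group_circle_hom: "\<phi> \<in> dual_group T \<Longrightarrow> circle_hom (topspace T) \<phi>"
  by (auto simp: dual_group_def circle_hom_def continuous_map_in_subtopology)

lemma locally_convex_scaling_continuous:
  assumes T: "locally_convex_space T" and x: "x \<in> topspace T"
  shows "continuous_map euclideanreal T (\<lambda>t. t *\<^sub>R x)"
proof -
  have "continuous_map euclideanreal (prod_topology euclideanreal T) (\<lambda>t. (t, x))"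
    using x by (intro continuous_map_pairedI) auto
  moreover have "continuous_map (prod_topology euclideanreal T) T (\<lambda>(c, x). c *\<^sub>R x)"
    using T by (simp add: locally_convex_space_def)
  ultimately have "continuous_map euclideanreal T ((\<lambda>(c, x). c *\<^sub>R x) \<circ> (\<lambda>t. (t, x)))"
    by (rule continuous_map_compose)
  then show ?thesis by (simp add: o_def)
qed

text \<open>On the line through \<open>x\<close> the character \<open>\<phi>\<close> is an exponential; the frequency is its unique
  exponent, that is, the value at \<open>x\<close> of the linear functional of which \<open>\<phi>\<close> is the exponential.\<close>
definition frequency :: "('v::real_vector \<Rightarrow> complex) \<Rightarrow> 'v \<Rightarrow> real" where
  "frequency \<phi> x = (THE s. \<forall>t. \<phi> (t *\<^sub>R x) = cis (t * s))"

lemma frequency_eqI: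
  assumes "\<And>t. \<phi> (t *\<^sub>R x) = cis (t * s)"
  shows "frequency \<phi> x = s"
  unfolding frequency_def using assms
  by (intro the_equality allI) (auto intro: cis_line_inject)

lemma character_line:
  assumes T: "locally_convex_space T" and \<phi>: "\<phi> \<in> dual_group T" and x: "x \<in> topspace T"
  shows "\<phi> (t *\<^sub>R x) = cis (t * frequency \<phi> x)"
proof -
  have sub: "t *\<^sub>R x \<in> topspace T" for t
    using T x by (simp add: locally_convex_space_def subspace_scale)
  have "continuous_map T euclidean \<phi>"
    using \<phi> by (simp add: dual_group_def continuous_map_in_subtopology)
  from continuous_map_compose[OF locally_convex_scaling_continuous[OF T x] this]
  have "continuous_on UNIV (\<lambda>t. \<phi> (t *\<^sub>R x))" by (simp add: o_def)
  moreover have "norm (\<phi> (t *\<^sub>R x)) = 1" for t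
    using circle_homD(1)[OF dual_group_circle_hom[OF \<phi>] sub] .
  moreover have "\<phi> ((s + t) *\<^sub>R x) = \<phi> (s *\<^sub>R x) * \<phi> (t *\<^sub>R x)" for s t
    using circle_homD(2)[OF dual_group_circle_hom[OF \<phi>] sub sub] by (simp add: scaleR_add_left)
  ultimately have "\<exists>s. \<forall>t. \<phi> (t *\<^sub>R x) = cis (t * s)"
    by (rule real_character[of "\<lambda>t. \<phi> (t *\<^sub>R x)"]) blast
  then obtain s where s: "\<And>t. \<phi> (t *\<^sub>R x) = cis (t * s)" by blast
  then show ?thesis using frequency_eqI[of \<phi> x s] by simp
qed

lemma frequency_add:
  assumes T: "locally_convex_space T" and \<phi>: "\<phi> \<in> dual_group T"
    and x: "x \<in> topspace T" "y \<in> topspace T"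
  shows "frequency \<phi> (x + y) = frequency \<phi> x + frequency \<phi> y"
proof (rule frequency_eqI)
  fix t
  have "t *\<^sub>R x \<in> topspace T" "t *\<^sub>R y \<in> topspace T"
    using T x by (auto simp: locally_convex_space_def subspace_scale)
  then show "\<phi> (t *\<^sub>R (x + y)) = cis (t * (frequency \<phi> x + frequency \<phi> y))"
    using circle_homD(2)[OF dual_group_circle_hom[OF \<phi>]] character_line[OF T \<phi>] x
    by (simp add: scaleR_add_right cis_mult distrib_left)
qed

lemma frequency_scaleR:
  assumes T: "locally_convex_space T" and \<phi>: "\<phi> \<in> dual_group T" and x: "x \<in> topspace T"
  shows "frequency \<phi> (c *\<^sub>R x) = c * frequency \<phi> x"
proof (rule frequency_eqI)
  fix t
  show "\<phi> (t *\<^sub>R c *\<^sub>R x) = cis (t * (c * frequency \<phi> x))"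
    using character_line[OF T \<phi> x, of "t * c"] by (simp add: mult.assoc)
qed


section \<open>Barrelled spaces as Mackey groups\<close>

definition circle_polar :: "'g::ab_group_add topology \<Rightarrow> 'g set \<Rightarrow> ('g \<Rightarrow> complex) set" where
  "circle_polar T U = {\<phi> \<in> dual_group T. \<phi> ` U \<subseteq> circle_plus}"

text \<open>Polars of neighbourhoods are compact for pointwise convergence.  The cluster point exists by
  Tychonoff; it is a homomorphism into the circle that maps \<open>U\<close> into the right half, as these are
  closed conditions, and such homomorphisms are automatically continuous.\<close>
lemma circle_polar_sequence_cluster:
  fixes \<phi> :: "nat \<Rightarrow> 'g::ab_group_add \<Rightarrow> complex"
  assumes T: "topological_abelian_group T" and U: "openin T U" "0 \<in> U"
    and \<phi>: "\<And>n. \<phi> n \<in> circle_polar T U"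
  obtains \<psi> where "\<psi> \<in> dual_group T"
    "\<And>x n e. x \<in> topspace T \<Longrightarrow> e > 0 \<Longrightarrow> \<exists>m\<ge>n. norm (\<phi> m x - \<psi> x) < e"
proof -
  let ?E = "topspace T"
  note T' = topological_abelian_groupD[OF T]
  have UE: "U \<subseteq> ?E" using openin_subset[OF U(1)] .
  define P where "P = product_topology (\<lambda>_. top_of_set circle) ?E"
  have "compact_space (top_of_set circle)"
    by (simp add: compact_space_subtopology circle_def)
  then have P: "compact_space P"
    unfolding P_def by (simp add: compact_space_product_topology)
  have proj: "continuous_map P euclidean (\<lambda>p. p x)" if "x \<in> ?E" for x
  proof -
    have "continuous_map P (top_of_set circle) (\<lambda>p. p x)"
      unfolding P_def by (rule continuous_map_product_projection[OF that])
    then show ?thesis by (simp add: continuous_map_in_subtopology)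
  qed
  have \<phi>P: "\<phi> n \<in> topspace P" for n
    using \<phi>[of n] by (auto simp: P_def circle_polar_def dual_group_def continuous_map_in_subtopology
        PiE_def Pi_def)
  define C where "C n = P closure_of (\<phi> ` {n..})" for n
  have "(\<Inter>n. C n) \<noteq> {}"
  proof (rule compact_space_imp_nest[OF P])
    show "closedin P (C n)" for n by (simp add: C_def)
    show "C n \<noteq> {}" for n
    proof -
      have "\<phi> ` {n..} \<subseteq> C n"
        unfolding C_def using \<phi>P by (intro closure_of_subset) auto
      then have "\<phi> n \<in> C n" by auto
      then show ?thesis by blast
    qed
    show "decseq C" unfolding C_def by (intro antimonoI closure_of_mono image_mono) auto
  qed
  then obtain \<psi> where \<psi>: "\<And>n. \<psi> \<in> C n" by blast
  have \<psi>P: "\<psi> \<in> topspace P" using \<psi>[of 0] closure_of_subset_topspace[of P] unfolding C_def by blast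
  have near: "\<exists>m\<ge>n. norm (\<phi> m x - \<psi> x) < e" if x: "x \<in> ?E" and e: "e > 0" for x n and e :: real
  proof -
    have "openin P {p \<in> topspace P. p x \<in> ball (\<psi> x) e}"
      by (rule openin_continuous_map_preimage[OF proj[OF x]]) simp
    moreover have "\<psi> \<in> {p \<in> topspace P. p x \<in> ball (\<psi> x) e}" using \<psi>P e by simp
    moreover have "\<forall>T. \<psi> \<in> T \<and> openin P T \<longrightarrow> (\<exists>p. p \<in> \<phi> ` {n..} \<and> p \<in> T)"
      using \<psi>[of n] unfolding C_def in_closure_of by blast
    ultimately have "\<exists>p. p \<in> \<phi> ` {n..} \<and> p \<in> {p \<in> topspace P. p x \<in> ball (\<psi> x) e}"
      by meson
    then show ?thesis by (auto simp: dist_norm norm_minus_commute)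
  qed
  have closed: "\<psi> \<in> F" if F: "closedin P F" "\<And>n. \<phi> n \<in> F" for F
  proof -
    have "C 0 \<subseteq> F" unfolding C_def using F by (intro closure_of_minimal) auto
    then show ?thesis using \<psi>[of 0] by blast
  qed
  have hom: "circle_hom ?E \<psi>"
    unfolding circle_hom_def
  proof (intro conjI ballI)
    show "\<psi> ` ?E \<subseteq> circle" using \<psi>P by (auto simp: P_def)
    fix x y assume xy: "x \<in> ?E" "y \<in> ?E"
    have "closedin P {p \<in> topspace P. p (x + y) - p x * p y \<in> {0}}"
    proof (rule closedin_continuous_map_preimage)
      show "continuous_map P euclidean (\<lambda>p. p (x + y) - p x * p y)"
        using proj[OF xy(1)] proj[OF xy(2)] proj[OF T'(2)[OF xy]]
        by (simp add: continuous_map_atin tendsto_diff tendsto_mult)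
    qed simp
    moreover have "\<phi> n \<in> {p \<in> topspace P. p (x + y) - p x * p y \<in> {0}}" for n
      using \<phi>P \<phi>[of n] xy by (simp add: circle_polar_def dual_group_def)
    ultimately have "\<psi> \<in> {p \<in> topspace P. p (x + y) - p x * p y \<in> {0}}" by (rule closed)
    then show "\<psi> (x + y) = \<psi> x * \<psi> y" by simp
  qed
  have "\<psi> x \<in> circle_plus" if x: "x \<in> U" for x
  proof -
    have "closedin P {p \<in> topspace P. p x \<in> {z. 0 \<le> Re z}}"
      using x UE by (intro closedin_continuous_map_preimage[OF proj])
        (auto simp: closed_halfspace_Re_ge)
    moreover have "\<phi> n \<in> {p \<in> topspace P. p x \<in> {z. 0 \<le> Re z}}" for n
      using \<phi>P \<phi>[of n] x by (auto simp: circle_polar_def circle_plus_def)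
    ultimately have "\<psi> \<in> {p \<in> topspace P. p x \<in> {z. 0 \<le> Re z}}" by (rule closed)
    then have "0 \<le> Re (\<psi> x)" by simp
    moreover have "\<psi> x \<in> circle" using hom x UE by (auto simp: circle_hom_def)
    ultimately show ?thesis by (simp add: circle_plus_def)
  qed
  then have "continuous_map T (top_of_set circle) \<psi>"
    by (intro circle_hom_continuous_if_bounded_near_zero[OF T hom U]) blast
  moreover have "\<psi> \<in> extensional ?E" using \<psi>P by (simp add: P_def PiE_def)
  ultimately have "\<psi> \<in> dual_group T"
    using circle_homD(2)[OF hom] by (simp add: dual_group_def)
  then show thesis using near by (rule that)
qed

text \<open>If the frequencies are unbounded, choose characters \<open>\<phi> n\<close> with lacunary frequencies and a cluster
  point \<open>\<psi>\<close>.  For large \<open>k\<close> there is a tiny time \<open>t\<close> at which all \<open>\<phi> n\<close> with \<open>n \<ge> k\<close> have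
  nonpositive real part, whereas \<open>\<psi>\<close>, being continuous along the line, is still near \<open>1\<close>.  The
  argument works simultaneously for all possible frequencies of \<open>\<psi>\<close>, so the lacunary sequence can be
  fixed before \<open>\<psi>\<close> is known.\<close>
lemma circle_polar_frequency_bounded:
  assumes T: "locally_convex_space T" and N: "topological_abelian_group N"
    and compat: "compatible_topologies T N" and U: "openin N U" "0 \<in> U" and x: "x \<in> topspace T"
  shows "\<exists>b. \<forall>\<phi>\<in>circle_polar N U. \<bar>frequency \<phi> x\<bar> \<le> b"
proof (rule ccontr)
  assume "\<not> ?thesis"
  then have unb: "\<exists>\<phi>\<in>circle_polar N U. b < \<bar>frequency \<phi> x\<bar>" for b by (meson not_le)
  have dual: "dual_group N = dual_group T" and E: "topspace N = topspace T"
    using compat by (auto simp: compatible_topologies_def)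
  have sub: "t *\<^sub>R x \<in> topspace T" for t
    using T x by (simp add: locally_convex_space_def subspace_scale)
  have "\<exists>\<phi>. \<forall>n::nat. (\<phi> n \<in> circle_polar N U \<and> 1 < \<bar>frequency (\<phi> n) x\<bar>) \<and>
      3 * \<bar>frequency (\<phi> n) x\<bar> < \<bar>frequency (\<phi> (Suc n)) x\<bar>"
  proof (rule dependent_nat_choice)
    show "\<exists>\<phi>. \<phi> \<in> circle_polar N U \<and> 1 < \<bar>frequency \<phi> x\<bar>" using unb[of 1] by blast
    fix \<phi> assume "\<phi> \<in> circle_polar N U \<and> 1 < \<bar>frequency \<phi> x\<bar>"
    moreover obtain \<phi>' where "\<phi>' \<in> circle_polar N U" "3 * \<bar>frequency \<phi> x\<bar> < \<bar>frequency \<phi>' x\<bar>"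
      using unb by blast
    ultimately show "\<exists>\<phi>'. (\<phi>' \<in> circle_polar N U \<and> 1 < \<bar>frequency \<phi>' x\<bar>) \<and>
        3 * \<bar>frequency \<phi> x\<bar> < \<bar>frequency \<phi>' x\<bar>"
      by (intro exI[of _ \<phi>']) auto
  qed
  then obtain \<phi> where \<phi>: "\<And>n. \<phi> n \<in> circle_polar N U" "\<And>n. 1 < \<bar>frequency (\<phi> n) x\<bar>"
    "\<And>n. 3 * \<bar>frequency (\<phi> n) x\<bar> < \<bar>frequency (\<phi> (Suc n)) x\<bar>" by blast
  define a where "a n = \<bar>frequency (\<phi> n) x\<bar>" for n
  have a: "a n > 0" "3 * a n \<le> a (Suc n)" "1 < a n" for n
    using \<phi>(2,3)[of n] by (simp_all add: a_def)
  have an: "real n \<le> a n" for n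
  proof (induction n)
    case (Suc n)
    then show ?case using a(2,3)[of n] by simp
  qed (use a(1)[of 0] in simp)
  obtain \<psi> where \<psi>: "\<psi> \<in> dual_group N"
    "\<And>y n e. y \<in> topspace N \<Longrightarrow> e > 0 \<Longrightarrow> \<exists>m\<ge>n. norm (\<phi> m y - \<psi> y) < e"
    using circle_polar_sequence_cluster[where \<phi>=\<phi>, OF N U \<phi>(1)] by metis
  have \<psi>T: "\<psi> \<in> dual_group T" using \<psi>(1) dual by simp
  define s where "s = frequency \<psi> x"
  \<comment> \<open>Times are at most \<open>2 * pi / a k\<close> and \<open>k \<le> a k\<close>, so this \<open>k\<close> keeps the angle of \<open>\<psi>\<close> below
    \<open>pi / 3\<close>.\<close>
  obtain k :: nat where k: "6 * \<bar>s\<bar> < real k" using reals_Archimedean2 by blast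
  obtain t where t: "0 < t" "t \<le> 2 * pi / a k" "\<And>n. cos (t * a (k + n)) \<le> 0"
    using lacunary_cos_nonpos[of "\<lambda>n. a (k + n)"] a by auto
  have "t * \<bar>s\<bar> \<le> 2 * pi / a k * \<bar>s\<bar>" using t(2) by (rule mult_right_mono) simp
  also have "\<dots> = 2 * pi * \<bar>s\<bar> / a k" by simp
  also have "\<dots> \<le> pi / 3"
    using an[of k] k a(1)[of k] by (simp add: divide_le_eq)
  finally have "cos (pi / 3) \<le> cos (t * \<bar>s\<bar>)"
    using t(1) by (intro cos_monotone_0_pi_le) auto
  also have "cos (t * \<bar>s\<bar>) = Re (\<psi> (t *\<^sub>R x))"
    using character_line[OF T \<psi>T x, of t] by (cases "s \<ge> 0") (simp_all add: s_def)
  finally have Re\<psi>: "1/2 \<le> Re (\<psi> (t *\<^sub>R x))" by (simp add: cos_60)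
  obtain m where m: "m \<ge> k" "norm (\<phi> m (t *\<^sub>R x) - \<psi> (t *\<^sub>R x)) < 1/2"
    using \<psi>(2)[of "t *\<^sub>R x" "1/2" k] sub E by auto
  have "\<phi> m \<in> dual_group T" using \<phi>(1)[of m] dual by (simp add: circle_polar_def)
  from character_line[OF T this x, of t]
  have "Re (\<phi> m (t *\<^sub>R x)) = cos (t * a m)"
    by (cases "frequency (\<phi> m) x \<ge> 0") (simp_all add: a_def)
  also have "\<dots> \<le> 0" using t(3)[of "m - k"] m(1) by simp
  finally show False
    using Re\<psi> abs_Re_le_cmod[of "\<phi> m (t *\<^sub>R x) - \<psi> (t *\<^sub>R x)"] m(2) by simp
qed

text \<open>The barrel \<open>A\<close> consists of the vectors at which every character of the polar of \<open>U\<close> has frequency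
  at most \<open>pi / 2\<close>.  Linearity of the frequency makes it absolutely convex, pointwise boundedness makes
  it absorbing, and quasi-convexity of \<open>U\<close> gives \<open>A \<subseteq> U\<close>.\<close>
lemma compatible_quasi_convex_nbhd_barrelled:
  assumes T: "barrelled T" and N: "topological_abelian_group N"
    and compat: "compatible_topologies T N"
    and U: "quasi_convex N U" "openin N V" "0 \<in> V" "V \<subseteq> U"
  shows "nbhd_of_zero T U"
proof -
  have lcs: "locally_convex_space T" using T by (simp add: barrelled_def)
  have dual: "dual_group N = dual_group T" and E: "topspace N = topspace T"
    using compat by (auto simp: compatible_topologies_def)
  have subsp: "subspace (topspace T)" using lcs by (simp add: locally_convex_space_def)
  let ?P = "circle_polar N U"
  have PV: "?P \<subseteq> circle_polar N V" using U(4) by (auto simp: circle_polar_def)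
  have PT: "\<phi> \<in> dual_group T" if "\<phi> \<in> ?P" for \<phi> using that dual by (simp add: circle_polar_def)
  define A where "A = {x \<in> topspace T. \<forall>\<phi>\<in>?P. \<bar>frequency \<phi> x\<bar> \<le> pi / 2}"
  \<comment> \<open>Restated in terms of values of characters, the defining condition of \<open>A\<close> is closed.\<close>
  have half: "\<bar>s\<bar> \<le> pi / 2 \<longleftrightarrow> (\<forall>t\<in>{-1..1}. 0 \<le> cos (t * s))" for s
  proof
    assume s: "\<bar>s\<bar> \<le> pi / 2"
    show "\<forall>t\<in>{-1..1}. 0 \<le> cos (t * s)"
    proof
      fix t :: real assume "t \<in> {-1..1}"
      then have "\<bar>t\<bar> * \<bar>s\<bar> \<le> 1 * (pi / 2)" using s by (intro mult_mono) auto
      then have "\<bar>t * s\<bar> \<le> pi / 2" by (simp add: abs_mult)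
      then show "0 \<le> cos (t * s)" by (intro cos_ge_zero) auto
    qed
  next
    assume *: "\<forall>t\<in>{-1..1}. 0 \<le> cos (t * s)"
    show "\<bar>s\<bar> \<le> pi / 2"
    proof (rule ccontr)
      assume s: "\<not> \<bar>s\<bar> \<le> pi / 2"
      define t where "t = min 1 (pi / \<bar>s\<bar>)"
      have t: "t \<in> {-1..1}" "pi / 2 < t * \<bar>s\<bar>" "t * \<bar>s\<bar> \<le> pi"
      proof -
        have "\<bar>s\<bar> > 0" using s pi_gt_zero by linarith
        then show "t * \<bar>s\<bar> \<le> pi" "pi / 2 < t * \<bar>s\<bar>"
          using s by (auto simp: t_def min_def field_simps)
        have "0 \<le> t" "t \<le> 1" by (simp_all add: t_def)
        then show "t \<in> {-1..1}" by simp
      qed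
      have "cos (t * s) = cos (t * \<bar>s\<bar>)" by (cases "s \<ge> 0") auto
      also have "\<dots> < cos (pi / 2)" using t by (intro cos_monotone_0_pi) auto
      finally show False using *[rule_format, OF t(1)] by simp
    qed
  qed
  have "closedin T A"
  proof -
    define F where "F = (\<lambda>(\<phi>, t). {x \<in> topspace T. \<phi> (t *\<^sub>R x) \<in> {z. 0 \<le> Re z}}) ` (?P \<times> {-1..1})"
    have "closedin T S" if "S \<in> insert (topspace T) F" for S
    proof -
      have "closedin T {x \<in> topspace T. \<phi> (t *\<^sub>R x) \<in> {z. 0 \<le> Re z}}" if \<phi>: "\<phi> \<in> ?P" for \<phi> t
      proof (rule closedin_continuous_map_preimage)
        have "continuous_map T (prod_topology euclideanreal T) (\<lambda>x. (t, x))"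
          by (intro continuous_map_pairedI) auto
        moreover have "continuous_map (prod_topology euclideanreal T) T (\<lambda>(c, x). c *\<^sub>R x)"
          using lcs by (simp add: locally_convex_space_def)
        moreover have "continuous_map T euclidean \<phi>"
          using PT[OF \<phi>] by (simp add: dual_group_def continuous_map_in_subtopology)
        ultimately have "continuous_map T euclidean (\<phi> \<circ> ((\<lambda>(c, x). c *\<^sub>R x) \<circ> (\<lambda>x. (t, x))))"
          by (intro continuous_map_compose)
        then show "continuous_map T euclidean (\<lambda>x. \<phi> (t *\<^sub>R x))" by (simp add: o_def)
      qed (simp add: closed_halfspace_Re_ge)
      then show ?thesis using that by (auto simp: F_def)
    qed
    then have "closedin T (\<Inter>(insert (topspace T) F))" by (intro closedin_Inter) auto
    moreover have "A = {x \<in> topspace T. \<forall>\<phi>\<in>?P. \<forall>t\<in>{-1..1}. 0 \<le> Re (\<phi> (t *\<^sub>R x))}"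
      unfolding A_def half by (auto simp: character_line[OF lcs PT])
    moreover have "\<dots> = \<Inter>(insert (topspace T) F)" unfolding F_def by auto
    ultimately show ?thesis by simp
  qed
  moreover have "convex A"
  proof (rule convexI)
    fix x y and u v :: real
    assume xy: "x \<in> A" "y \<in> A" and uv: "0 \<le> u" "0 \<le> v" "u + v = 1"
    have E': "u *\<^sub>R x \<in> topspace T" "v *\<^sub>R y \<in> topspace T"
      using xy subsp by (auto simp: A_def subspace_scale)
    have "\<bar>frequency \<phi> (u *\<^sub>R x + v *\<^sub>R y)\<bar> \<le> pi / 2" if \<phi>: "\<phi> \<in> ?P" for \<phi>
    proof -
      have xy': "x \<in> topspace T" "y \<in> topspace T" "\<bar>frequency \<phi> x\<bar> \<le> pi / 2" "\<bar>frequency \<phi> y\<bar> \<le> pi / 2"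
        using xy \<phi> by (auto simp: A_def)
      have "frequency \<phi> (u *\<^sub>R x + v *\<^sub>R y) = u * frequency \<phi> x + v * frequency \<phi> y"
        using frequency_add[OF lcs PT[OF \<phi>] E'] xy' by (simp add: frequency_scaleR[OF lcs PT[OF \<phi>]])
      also have "\<bar>\<dots>\<bar> \<le> \<bar>u * frequency \<phi> x\<bar> + \<bar>v * frequency \<phi> y\<bar>" by (rule abs_triangle_ineq)
      also have "\<dots> = u * \<bar>frequency \<phi> x\<bar> + v * \<bar>frequency \<phi> y\<bar>" using uv by (simp add: abs_mult)
      also have "\<dots> \<le> pi / 2" using xy' uv by (intro convex_bound_le) auto
      finally show ?thesis .
    qed
    then show "u *\<^sub>R x + v *\<^sub>R y \<in> A" using E' subsp by (simp add: A_def subspace_add)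
  qed
  moreover have "balanced A"
    unfolding balanced_def
  proof (intro allI ballI impI)
    fix c :: real and x assume x: "x \<in> A" and c: "\<bar>c\<bar> \<le> 1"
    have "\<bar>c\<bar> * \<bar>frequency \<phi> x\<bar> \<le> 1 * (pi / 2)" if "\<phi> \<in> ?P" for \<phi>
      using x c that by (intro mult_mono) (auto simp: A_def)
    then show "c *\<^sub>R x \<in> A"
      using x subsp by (simp add: A_def subspace_scale frequency_scaleR[OF lcs PT] abs_mult)
  qed
  moreover have "absorbs A {x}" if x: "x \<in> topspace T" for x
  proof -
    obtain b where b: "\<And>\<phi>. \<phi> \<in> ?P \<Longrightarrow> \<bar>frequency \<phi> x\<bar> \<le> b"
      using circle_polar_frequency_bounded[OF lcs N compat U(2,3) x] PV by blast
    have "{x} \<subseteq> (\<lambda>y. c *\<^sub>R y) ` A" if c: "max 1 b \<le> \<bar>c\<bar>" for c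
    proof -
      have c0: "c \<noteq> 0" using c by auto
      have "\<bar>frequency \<phi> (inverse c *\<^sub>R x)\<bar> \<le> pi / 2" if \<phi>: "\<phi> \<in> ?P" for \<phi>
      proof -
        have "\<bar>frequency \<phi> (inverse c *\<^sub>R x)\<bar> = \<bar>frequency \<phi> x\<bar> / \<bar>c\<bar>"
          by (simp add: frequency_scaleR[OF lcs PT[OF \<phi>] x] abs_mult divide_inverse mult.commute)
        also have "\<dots> \<le> 1" using b[OF \<phi>] c c0 by simp
        also have "\<dots> \<le> pi / 2" using pi_ge_two by simp
        finally show ?thesis .
      qed
      then have "inverse c *\<^sub>R x \<in> A" using x subsp by (simp add: A_def subspace_scale)
      moreover have "x = c *\<^sub>R (inverse c *\<^sub>R x)" using c0 by simp
      ultimately show ?thesis by blast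
    qed
    then show ?thesis unfolding absorbs_def by (intro exI[of _ "max 1 b"]) auto
  qed
  ultimately have "barrel T A" by (simp add: barrel_def absolutely_convex_def)
  then have "nbhd_of_zero T A" using T by (simp add: barrelled_def)
  moreover have "A \<subseteq> U"
  proof
    fix x assume x: "x \<in> A"
    show "x \<in> U"
    proof (rule ccontr)
      assume "x \<notin> U"
      moreover have "x \<in> topspace N" using x E by (simp add: A_def)
      ultimately obtain \<phi> where \<phi>: "\<phi> \<in> dual_group N" "\<phi> x \<notin> circle_plus" "\<phi> ` U \<subseteq> circle_plus"
        using U(1) unfolding quasi_convex_def by blast
      then have "\<phi> \<in> ?P" by (simp add: circle_polar_def)
      then have "\<bar>frequency \<phi> x\<bar> \<le> pi / 2" "x \<in> topspace T" using x by (auto simp: A_def)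
      then have "\<forall>t\<in>{-1..1}. 0 \<le> cos (t * frequency \<phi> x)" "x \<in> topspace T" using half by blast+
      then have "0 \<le> cos (1 * frequency \<phi> x)" by (intro bspec[where x=1]) auto
      then have "0 \<le> Re (\<phi> x)"
        using character_line[OF lcs PT[OF \<open>\<phi> \<in> ?P\<close>] \<open>x \<in> topspace T\<close>, of 1] by simp
      moreover have "\<phi> x \<in> circle"
        using dual_group_circle_hom[OF \<phi>(1)] \<open>x \<in> topspace N\<close> by (auto simp: circle_hom_def)
      ultimately show False using \<phi>(2) by (simp add: circle_plus_def)
    qed
  qed
  moreover have "U \<subseteq> topspace T" using U(1) E by (simp add: quasi_convex_def)
  ultimately show ?thesis unfolding nbhd_of_zero_def by blast
qed

theorem barrelled_imp_Mackey_group: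
  assumes T: "barrelled T" and lqc: "locally_quasi_convex T"
  shows "Mackey_group T"
  unfolding Mackey_group_def
proof (intro conjI lqc allI impI, elim conjE)
  fix N assume N: "locally_quasi_convex N" and compat: "compatible_topologies T N"
  have E: "topspace N = topspace T" using compat by (simp add: compatible_topologies_def)
  have grpN: "topological_abelian_group N"
    using N by (simp add: locally_quasi_convex_def MAP_group_def)
  have grpT: "topological_abelian_group T"
    using lqc by (simp add: locally_quasi_convex_def MAP_group_def)
  show "coarser N T"
    unfolding coarser_def
  proof (intro allI impI)
    fix V assume V: "openin N V"
    show "openin T V"
    proof (subst openin_subopen, intro ballI)
      fix v assume v: "v \<in> V"
      have vE: "v \<in> topspace T" "v \<in> topspace N" using v openin_subset[OF V] E by auto
      define W where "W = {x \<in> topspace N. v + x \<in> V}"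
      have "openin N W"
        unfolding W_def by (rule openin_continuous_map_preimage[OF topological_abelian_groupD(4)[OF grpN vE(2)] V])
      moreover have "0 \<in> W" using v topological_abelian_groupD(1)[OF grpN] by (simp add: W_def)
      ultimately obtain U0 U where U: "openin N U0" "quasi_convex N U" "0 \<in> U0" "U0 \<subseteq> U" "U \<subseteq> W"
        using N unfolding locally_quasi_convex_def neighbourhood_base_at_def by metis
      then have "nbhd_of_zero T U"
        using compatible_quasi_convex_nbhd_barrelled[OF T grpN compat] by blast
      then obtain O' where O': "openin T O'" "0 \<in> O'" "O' \<subseteq> U" unfolding nbhd_of_zero_def by blast
      have "openin T {y \<in> topspace T. - v + y \<in> O'}"
        by (rule openin_continuous_map_preimage[OF topological_abelian_groupD(4)[OF grpT] O'(1)])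
           (rule topological_abelian_groupD(3)[OF grpT vE(1)])
      moreover have "v \<in> {y \<in> topspace T. - v + y \<in> O'}" using vE O'(2) by simp
      moreover have "{y \<in> topspace T. - v + y \<in> O'} \<subseteq> V"
        using O'(3) U(5) by (force simp: W_def)
      ultimately show "\<exists>S. openin T S \<and> v \<in> S \<and> S \<subseteq> V" by blast
    qed
  qed
qed

theorem corollary1p5:
  fixes X :: "'a topology"
  assumes "Tychonoff_space X"
    and "bornological (C_k X)"
  shows "barrelled (C_k X) \<longleftrightarrow> Mackey_group (C_k X)"
proof -
  have "completely_regular_space X" using assms(1) by (simp add: Tychonoff_space_def)
  then have "barrelled (C_k X)" using bornological_C_k_imp_barrelled assms(2) by blast
  moreover have "locally_convex_space (C_k X)" using assms(2) by (simp add: bornological_def)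
  then have "locally_quasi_convex (C_k X)" by (rule locally_quasi_convex_C_k)
  ultimately show ?thesis using barrelled_imp_Mackey_group by blast
qed

end
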